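(* Let $n_1,n_2$ be positive integers, $\varepsilon>0$, $\rho_1\in\mathrm{H}_{n_1,++}$, $\rho_2\in\mathrm{H}_{n_2,++}$ with $\operatorname{tr}\rho_1=\operatorname{tr}\rho_2$, and $C\in\mathrm{H}_{n_1n_2}$. For $(X,Y)\in\mathrm{H}_{n_1}\times\mathrm{H}_{n_2}$ let $C(X,Y)=C-X\otimes I_{n_2}-I_{n_1}\otimes Y$, and set $\hat{\mathrm{D}}=\{(X,Y)\in\mathrm{H}_{n_1}\times\mathrm{H}_{n_2}:\ C(X,Y)\succ 0\}$, $\mathrm{D}=\{(X,Y)\in\hat{\mathrm{D}}:\ \operatorname{tr}X=\operatorname{tr}Y\}$, $\beta_Q(X,Y)=-\log\det C(X,Y)$ on $\hat{\mathrm{D}}$, and $$\varphi(X,Y,C)=\operatorname{tr}\rho_1X+\operatorname{tr}\rho_2Y-\varepsilon\beta_Q(X,Y)+n_1n_2\varepsilon(1-\log\varepsilon).$$ Then $\varphi$ is concave on $\hat{\mathrm{D}}$ and strictly concave on $\mathrm{D}$, and $$\max_{(X,Y)\in\hat{\mathrm{D}}}\varphi(X,Y,C)=\max_{(X,Y)\in\mathrm{D}}\varphi(X,Y,C)=\kappa_\beta(C,R,\varepsilon).$$ The function $\varphi$ achieves its maximum on $\hat{\mathrm D}$ exactly on a line $\mathrm{L}=\{(U_1,U_2)+t(I_{n_1},-I_{n_2}):t\in\mathbb{R}\}$, which intersects $\mathrm{D}$ at a unique point $(U_1,U_2)$. Furthermore, $\rho^\star=\varepsilon\,C(X,Y)^{-1}$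 (which is the same for all $(X,Y)\in\mathrm{L}$) is the unique point of $\Gamma_o(R)$ at which $\kappa_\beta(C,R,\varepsilon)$ is achieved.
   Context: $\mathrm{H}_n$ denotes $n\times n$ complex Hermitian matrices, $\mathrm{H}_{n,+}$ ($A\succeq0$) the positive semidefinite and $\mathrm{H}_{n,++}$ ($A\succ0$) the positive definite ones; $\mathrm{H}_{n_1n_2}$ is identified with Hermitian operators on $\mathbb{C}^{n_1}\otimes\mathbb{C}^{n_2}$. For $\rho\in\mathrm{H}_{n_1n_2}$, $\operatorname{tr}_2\rho\in\mathrm{H}_{n_1}$ and $\operatorname{tr}_1\rho\in\mathrm{H}_{n_2}$ are the partial traces over the second and first factor. For $R=(\rho_1,\rho_2)$, $\Gamma(R)=\{\rho\in\mathrm{H}_{n_1n_2,+}:\ \operatorname{tr}_2\rho=\rho_1,\ \operatorname{tr}_1\rho=\rho_2\}$ and $\Gamma_o(R)=\Gamma(R)\cap\mathrm{H}_{n_1n_2,++}$. $\kappa_\beta(C,R,\varepsilon)=\min_{\rho\in\Gamma_o(R)}\big(\operatorname{tr}C\rho-\varepsilon\log\det\rho\big)$. *)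

theory Defs
  imports "HOL-Analysis.Analysis"
begin

(* Complex n x n matrices are rendered as complex^'n^'n with a finite index type 'n;
   C^{n1} (x) C^{n2} is indexed by the product type 'a \<times> 'b. *)

definition hermitian :: "complex^'n^'n \<Rightarrow> bool" where
  "hermitian A \<longleftrightarrow> (\<forall>i j. A $ i $ j = cnj (A $ j $ i))"

definition pos_def :: "complex^'n^'n \<Rightarrow> bool" where
  "pos_def A \<longleftrightarrow> hermitian A \<and>
     (\<forall>x::complex^'n. x \<noteq> 0 \<longrightarrow> Re (\<Sum>i\<in>UNIV. \<Sum>j\<in>UNIV. cnj (x $ i) * A $ i $ j * x $ j) > 0)"

definition kron :: "complex^'a::finite^'a \<Rightarrow> complex^'b::finite^'b \<Rightarrow> complex^('a::finite \<times> 'b::finite)^('a \<times> 'b)" where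
  "kron A B = (\<chi> p q. A $ fst p $ fst q * B $ snd p $ snd q)"

definition ptr2 :: "complex^('a::finite \<times> 'b::finite)^('a \<times> 'b) \<Rightarrow> complex^'a::finite^'a" where
  "ptr2 \<rho> = (\<chi> i j. \<Sum>k\<in>UNIV. \<rho> $ (i, k) $ (j, k))"

definition ptr1 :: "complex^('a::finite \<times> 'b::finite)^('a \<times> 'b) \<Rightarrow> complex^'b::finite^'b" where
  "ptr1 \<rho> = (\<chi> i j. \<Sum>k\<in>UNIV. \<rho> $ (k, i) $ (k, j))"

definition Gamma_o :: "complex^'a::finite^'a \<Rightarrow> complex^'b::finite^'b \<Rightarrow> (complex^('a::finite \<times> 'b::finite)^('a \<times> 'b)) set" where
  "Gamma_o \<rho>1 \<rho>2 = {\<rho>. pos_def \<rho> \<and> ptr2 \<rho> = \<rho>1 \<and> ptr1 \<rho> = \<rho>2}"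

text \<open>Objective tr(C rho) - eps log det rho (real for Hermitian C, positive definite rho).\<close>
definition kappa_obj :: "complex^('a::finite \<times> 'b::finite)^('a \<times> 'b) \<Rightarrow> real \<Rightarrow> complex^('a::finite \<times> 'b::finite)^('a \<times> 'b) \<Rightarrow> real" where
  "kappa_obj C \<epsilon> \<rho> = Re (trace (C ** \<rho>)) - \<epsilon> * ln (Re (det \<rho>))"

text \<open>kappa_beta(C,R,eps) = min over Gamma_o(R) of the objective (rendered as the infimum,
  which equals the minimum whenever the minimum is attained).\<close>
definition kappa_beta :: "complex^('a::finite \<times> 'b::finite)^('a \<times> 'b) \<Rightarrow> complex^'a::finite^'a \<Rightarrow> complex^'b::finite^'b \<Rightarrow> real \<Rightarrow> real" where
  "kappa_beta C \<rho>1 \<rho>2 \<epsilon> = (INF \<rho>\<in>Gamma_o \<rho>1 \<rho>2. kappa_obj C \<epsilon> \<rho>)"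

definition CXY :: "complex^('a::finite \<times> 'b::finite)^('a \<times> 'b) \<Rightarrow> complex^'a::finite^'a \<Rightarrow> complex^'b::finite^'b \<Rightarrow> complex^('a::finite \<times> 'b::finite)^('a \<times> 'b)" where
  "CXY C X Y = C - kron X (mat 1) - kron (mat 1) Y"

definition Dhat :: "complex^('a::finite \<times> 'b::finite)^('a \<times> 'b) \<Rightarrow> ((complex^'a::finite^'a) \<times> (complex^'b::finite^'b)) set" where
  "Dhat C = {(X, Y). hermitian X \<and> hermitian Y \<and> pos_def (CXY C X Y)}"

definition Dset :: "complex^('a::finite \<times> 'b::finite)^('a \<times> 'b) \<Rightarrow> ((complex^'a::finite^'a) \<times> (complex^'b::finite^'b)) set" where
  "Dset C = {(X, Y) \<in> Dhat C. trace X = trace Y}"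

definition betaQ :: "complex^('a::finite \<times> 'b::finite)^('a \<times> 'b) \<Rightarrow> complex^'a::finite^'a \<Rightarrow> complex^'b::finite^'b \<Rightarrow> real" where
  "betaQ C X Y = - ln (Re (det (CXY C X Y)))"

definition phi :: "complex^'a::finite^'a \<Rightarrow> complex^'b::finite^'b \<Rightarrow> real \<Rightarrow> complex^('a::finite \<times> 'b::finite)^('a \<times> 'b) \<Rightarrow>
    (complex^'a::finite^'a) \<times> (complex^'b::finite^'b) \<Rightarrow> real" where
  "phi \<rho>1 \<rho>2 \<epsilon> C XY = Re (trace (\<rho>1 ** fst XY)) + Re (trace (\<rho>2 ** snd XY))
     - \<epsilon> * betaQ C (fst XY) (snd XY)
     + real (CARD('a) * CARD('b)) * \<epsilon> * (1 - ln \<epsilon>)"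

definition strict_concave_on :: "'v::real_vector set \<Rightarrow> ('v \<Rightarrow> real) \<Rightarrow> bool" where
  "strict_concave_on S f \<longleftrightarrow> convex S \<and>
     (\<forall>x\<in>S. \<forall>y\<in>S. x \<noteq> y \<longrightarrow> (\<forall>u::real. 0 < u \<and> u < 1 \<longrightarrow>
        f (u *\<^sub>R x + (1 - u) *\<^sub>R y) > u * f x + (1 - u) * f y))"

end

theory Submission
  imports Defs
begin

text \<open>For positive definite \<open>M\<close> and \<open>\<rho>\<close> of size \<open>N\<close>, the gap
  \<open>tr (M \<rho>) - \<epsilon> ln det \<rho> - \<epsilon> ln det M - N \<epsilon> (1 - ln \<epsilon>)\<close> is nonnegative and vanishes exactly when
  \<open>M \<rho> = \<epsilon> I\<close>: it is a sum of terms \<open>m - \<epsilon> ln m - \<epsilon> (1 - ln \<epsilon>)\<close> over the eigenvalues \<open>m\<close> of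
  \<open>S\<^sup>* M S\<close>, where \<open>\<rho> = S S\<^sup>*\<close>. With \<open>M = C(X,Y)\<close> the gap is the difference of the primal and
  the dual objective, so this single inequality yields weak duality with its equality case; with
  \<open>\<epsilon> = 1\<close> it yields the strict concavity of \<open>ln det\<close>. Strong duality follows from a minimiser of the
  primal problem: its first-order condition says that \<open>C - \<epsilon> \<rho>\<^sup>-\<^sup>1\<close> is orthogonal to all
  Hermitian matrices with vanishing partial traces, i.e. is of the form
  \<open>X \<otimes> I + I \<otimes> Y\<close>. The kernel of the map \<open>(X, Y) \<mapsto> X \<otimes> I + I \<otimes> Y\<close> is the line spanned by
  \<open>(I, -I)\<close>.\<close>

section \<open>Hermitian matrices\<close>

definition adj :: "complex^'n^'m \<Rightarrow> complex^'m^'n" where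
  "adj A = (\<chi> i j. cnj (A $ j $ i))"

definition diag :: "('n \<Rightarrow> real) \<Rightarrow> complex^'n^'n" where
  "diag d = (\<chi> i j. if i = j then of_real (d i) else 0)"

text \<open>Conjugate-linear in the first argument. Both this form and its real part
  \<open>\<bullet>\<close> are kept: minimisation uses the real one, while orthogonal complements
  have to be complex subspaces.\<close>

definition cinner :: "complex^'n \<Rightarrow> complex^'n \<Rightarrow> complex" where
  "cinner x y = (\<Sum>i\<in>UNIV. cnj (x $ i) * y $ i)"

lemma adj_nth [simp]: "adj A $ i $ j = cnj (A $ j $ i)"
  by (simp add: adj_def)

lemma adj_adj [simp]: "adj (adj A) = A"
  by (simp add: vec_eq_iff)

lemma adj_mat_1 [simp]: "adj (mat 1) = mat 1"
  by (simp add: vec_eq_iff mat_def)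

lemma adj_diag [simp]: "adj (diag d) = diag d"
  by (simp add: vec_eq_iff diag_def)

lemma adj_add: "adj (A + B) = adj A + adj B"
  by (simp add: vec_eq_iff)

lemma adj_diff: "adj (A - B) = adj A - adj B"
  by (simp add: vec_eq_iff)

lemma adj_scaleR: "adj (r *\<^sub>R A) = r *\<^sub>R adj A"
  by (simp add: vec_eq_iff)

lemma adj_mult: "adj (A ** B) = adj B ** adj A"
  by (simp add: vec_eq_iff matrix_matrix_mult_def mult.commute)

lemma hermitian_iff_adj: "hermitian A \<longleftrightarrow> adj A = A"
  unfolding hermitian_def vec_eq_iff adj_nth by metis

lemma cinner_mult_right: "cinner x (A *v y) = cinner (adj A *v x) y"
proof -
  have "cinner x (A *v y) = (\<Sum>i\<in>UNIV. \<Sum>j\<in>UNIV. cnj (x $ i) * (A $ i $ j * y $ j))"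
    by (simp add: cinner_def matrix_vector_mult_def sum_distrib_left)
  also have "\<dots> = (\<Sum>j\<in>UNIV. \<Sum>i\<in>UNIV. cnj (x $ i) * (A $ i $ j * y $ j))"
    by (rule sum.swap)
  also have "\<dots> = cinner (adj A *v x) y"
    by (simp add: cinner_def matrix_vector_mult_def sum_distrib_right) (simp add: mult_ac)
  finally show ?thesis .
qed

lemma inner_eq_Re_cnj: "(a::complex) \<bullet> b = Re (cnj a * b)"
  by (simp add: inner_complex_def)

lemma inner_eq_Re_cinner: "x \<bullet> y = Re (cinner x y)"
  by (simp add: inner_vec_def cinner_def inner_eq_Re_cnj)

lemma inner_mult_right: "x \<bullet> (A *v y) = (adj A *v x) \<bullet> (y::complex^'n)"
  by (simp add: inner_eq_Re_cinner cinner_mult_right)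

text \<open>Makes Cauchy-Schwarz, norms and orthogonality available for traces: the Euclidean
  structure on matrices is the real Hilbert-Schmidt one.\<close>

lemma inner_matrix_eq_trace: "A \<bullet> B = Re (trace (adj A ** B))"
  unfolding trace_def inner_vec_def inner_eq_Re_cnj
  by (simp add: matrix_matrix_mult_def) (rule sum.swap)

text \<open>Cyclicity of the trace moves a congruence from one factor to the other; changes of basis
  inside inner products use this.\<close>

lemma inner_congruence: "(adj T ** A ** T) \<bullet> B = A \<bullet> (T ** B ** adj T)"
  for A B :: "complex^'n^'n"
proof -
  have "trace (adj (adj T ** A ** T) ** B) = trace (adj T ** (adj A ** T ** B))"
    by (simp add: adj_mult matrix_mul_assoc)
  also have "\<dots> = trace (adj A ** (T ** B ** adj T))"
    by (subst trace_mul_sym) (simp add: matrix_mul_assoc)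
  finally show ?thesis by (simp only: inner_matrix_eq_trace)
qed

lemma hermitian_congruence: "hermitian A \<Longrightarrow> hermitian (adj T ** A ** T)"
  by (simp add: hermitian_iff_adj adj_mult matrix_mul_assoc)

lemma form_congruence: "x \<bullet> ((adj T ** A ** T) *v x) = (T *v x) \<bullet> (A *v (T *v x))"
  for x :: "complex^'n"
proof -
  have "(adj T ** A ** T) *v x = adj T *v (A *v (T *v x))"
    by (simp add: matrix_vector_mul_assoc matrix_mul_assoc)
  then show ?thesis
    using inner_mult_right[of x "adj T" "A *v (T *v x)"] by simp
qed

section \<open>Spectral theorem for Hermitian matrices\<close>

lemma cinner_add_right: "cinner x (y + z) = cinner x y + cinner x z"
  by (simp add: cinner_def algebra_simps sum.distrib)

lemma cinner_scaleR_right: "cinner x (r *\<^sub>R y) = r *\<^sub>R cinner x y"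
  by (simp add: cinner_def scaleR_sum_right)

lemma matrix_vector_scaleR: "A *v (r *\<^sub>R x) = r *\<^sub>R (A *v (x::complex^'n))"
  by (simp add: vec_eq_iff matrix_vector_mult_def scaleR_sum_right)

text \<open>There are fewer conditions than dimensions: placing the conjugated vectors as rows at
  the indices in \<open>S\<close> leaves row \<open>i\<close> zero, so the square matrix is singular
  and a nonzero kernel vector serves.\<close>

lemma exists_common_orthogonal:
  fixes v :: "'n::finite \<Rightarrow> complex^'n"
  assumes "i \<notin> S"
  obtains x where "x \<noteq> 0" "\<And>j. j \<in> S \<Longrightarrow> cinner (v j) x = 0"
proof -
  define M :: "complex^'n^'n" where "M = (\<chi> j k. if j \<in> S then cnj (v j $ k) else 0)"
  have "row i M = 0"
    using assms by (simp add: row_def M_def vec_eq_iff)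
  then have "det M = 0"
    by (rule det_zero_row)
  then have "\<not> invertible M"
    by (simp add: invertible_det_nz)
  then obtain x where x: "M *v x = 0" "x \<noteq> 0"
    using matrix_left_invertible_ker[of M] invertible_left_inverse[of M] by blast
  have "cinner (v j) x = 0" if "j \<in> S" for j
  proof -
    have "(M *v x) $ j = cinner (v j) x"
      using that by (simp add: M_def matrix_vector_mult_def cinner_def)
    then show ?thesis using x by simp
  qed
  with x that show ?thesis by blast
qed

lemma quadratic_nonneg_imp_zero:
  fixes a b :: real
  assumes "\<And>t. 0 \<le> 2 * t * a + t^2 * b" and "0 \<le> b"
  shows "a = 0"
proof (rule ccontr)
  assume "a \<noteq> 0"
  \<comment> \<open>The minimiser would be \<open>- a / b\<close>; the shift to \<open>b + 1\<close>
    keeps the denominator nonzero when \<open>b = 0\<close> and still gives a negative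
    value.\<close>
  have "0 \<le> 2 * (- a / (b + 1)) * a + (- a / (b + 1))^2 * b"
    by (rule assms)
  also have "\<dots> = - (a^2 * (b + 2)) / (b + 1)^2"
    using \<open>0 \<le> b\<close> by (simp add: divide_simps power2_eq_square) (simp add: algebra_simps)
  also have "\<dots> < 0"
    using \<open>a \<noteq> 0\<close> \<open>0 \<le> b\<close> by (simp add: divide_neg_pos)
  finally show False by simp
qed

text \<open>A minimiser of the quadratic form on the unit sphere of an invariant subspace
  is an eigenvector.\<close>
lemma hermitian_eigenvector_orthogonal:
  fixes A :: "complex^'n^'n" and v :: "'n \<Rightarrow> complex^'n"
  assumes A: "hermitian A"
    and eig: "\<And>j. j \<in> S \<Longrightarrow> A *v v j = complex_of_real (d j) *s v j"
    and "i \<notin> S"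
  obtains w l where "w \<bullet> w = 1" "\<And>j. j \<in> S \<Longrightarrow> cinner (v j) w = 0"
    "A *v w = complex_of_real l *s w"
proof -
  \<comment> \<open>\<open>V\<close> is the orthogonal complement of the eigenvectors found so far;
    it is invariant under \<open>A\<close> because \<open>A\<close> is Hermitian.\<close>
  define V where "V = {x. \<forall>j\<in>S. cinner (v j) x = 0}"
  define q where "q x = x \<bullet> (A *v x)" for x
  have V_scale: "r *\<^sub>R x \<in> V" if "x \<in> V" for r x
    using that by (simp add: V_def cinner_scaleR_right)
  have V_add: "x + y \<in> V" if "x \<in> V" "y \<in> V" for x y
    using that by (simp add: V_def cinner_add_right)
  have V_A: "A *v x \<in> V" if "x \<in> V" for x
  proof -
    have "cinner (v j) (A *v x) = 0" if "j \<in> S" for j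
    proof -
      have "cinner (v j) (A *v x) = cinner (complex_of_real (d j) *s v j) x"
        using A eig[OF that] by (simp add: cinner_mult_right hermitian_iff_adj)
      also have "\<dots> = of_real (d j) * cinner (v j) x"
        by (simp add: cinner_def sum_distrib_left mult.assoc)
      finally show ?thesis using \<open>x \<in> V\<close> that by (simp add: V_def)
    qed
    then show ?thesis by (simp add: V_def)
  qed
  have "closed {x. cinner (v j) x = 0}" for j
    unfolding cinner_def by (intro closed_Collect_eq continuous_intros)
  then have "closed V"
    unfolding V_def by (auto simp: Collect_ball_eq intro: closed_INT)
  define K where "K = sphere 0 1 \<inter> V"
  have "compact K"
    unfolding K_def by (rule compact_Int_closed[OF compact_sphere \<open>closed V\<close>])
  obtain x where x0: "x \<noteq> 0" and x: "\<And>j. j \<in> S \<Longrightarrow> cinner (v j) x = 0"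
    by (rule exists_common_orthogonal[OF \<open>i \<notin> S\<close>, of v]) (rule that)
  have "x \<in> V" using x by (simp add: V_def)
  from V_scale[OF this, of "1 / norm x"] have "(1 / norm x) *\<^sub>R x \<in> K"
    using x0 by (simp add: K_def)
  then have "K \<noteq> {}" by blast
  have "continuous_on K q"
    unfolding q_def by (intro continuous_intros linear_continuous_on matrix_vector_mul_linear
        linear_conv_bounded_linear[THEN iffD1])
  then obtain w where w: "w \<in> K" and wmin: "\<And>y. y \<in> K \<Longrightarrow> q w \<le> q y"
    using continuous_attains_inf[OF \<open>compact K\<close> \<open>K \<noteq> {}\<close>] by blast
  have wV: "w \<in> V" and ww: "w \<bullet> w = 1"
    using w by (auto simp: K_def norm_eq_1)
  define l where "l = q w"
  have q_scale: "q (r *\<^sub>R y) = r^2 * q y" for r y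
    by (simp add: q_def matrix_vector_scaleR power2_eq_square)
  have q_ge: "l * (y \<bullet> y) \<le> q y" if "y \<in> V" for y
  proof (cases "y = 0")
    case False
    have "(1 / norm y) *\<^sub>R y \<in> K"
      using V_scale[OF that] False by (simp add: K_def)
    then have "l \<le> q ((1 / norm y) *\<^sub>R y)"
      unfolding l_def by (rule wmin)
    then have "l \<le> q y / (y \<bullet> y)"
      by (simp add: q_scale power_one_over dot_square_norm)
    then show ?thesis using False by (simp add: field_simps)
  qed (simp add: q_def)
  \<comment> \<open>\<open>z\<close> is the residual of the eigenvalue equation. On \<open>V\<close>
    the form \<open>q y - l * (y \<bullet> y)\<close> is nonnegative, and it vanishes at
    \<open>w\<close>. Along \<open>w + t *\<^sub>R z\<close> its linear coefficient is
    \<open>2 * (z \<bullet> z)\<close>, which must therefore be zero.\<close>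
  define z where "z = A *v w + (- l) *\<^sub>R w"
  have "z \<in> V"
    unfolding z_def using wV by (intro V_add V_scale V_A)
  have sym: "z \<bullet> (A *v w) = w \<bullet> (A *v z)"
    using A inner_mult_right[of z A w] by (simp add: hermitian_iff_adj inner_commute)
  have "z \<bullet> z = 0"
  proof (rule quadratic_nonneg_imp_zero)
    show "0 \<le> q z - l * (z \<bullet> z)" using q_ge[OF \<open>z \<in> V\<close>] by simp
    fix t :: real
    have "w + t *\<^sub>R z \<in> V" using wV \<open>z \<in> V\<close> by (intro V_add V_scale)
    then have "0 \<le> q (w + t *\<^sub>R z) - l * ((w + t *\<^sub>R z) \<bullet> (w + t *\<^sub>R z))"
      using q_ge by force
    also have "\<dots> = q w - l * (w \<bullet> w) + 2 * t * (z \<bullet> (A *v w) - l * (z \<bullet> w))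
        + t^2 * (q z - l * (z \<bullet> z))"
      unfolding q_def using sym
      by (simp add: matrix_vector_right_distrib matrix_vector_scaleR inner_simps inner_commute
          algebra_simps power2_eq_square)
    also have "z \<bullet> (A *v w) - l * (z \<bullet> w) = z \<bullet> z"
      by (simp add: z_def inner_simps)
    finally show "0 \<le> 2 * t * (z \<bullet> z) + t^2 * (q z - l * (z \<bullet> z))"
      using ww by (simp add: l_def)
  qed
  then have "A *v w = l *\<^sub>R w"
    by (simp add: z_def)
  then have "A *v w = complex_of_real l *s w"
    by (simp add: vec_eq_iff flip: scaleR_conv_of_real)
  with that ww wV show ?thesis by (auto simp: V_def)
qed

text \<open>Induction adds one eigenvector orthogonal to the earlier ones. Since the vectors are
  indexed by matrix indices, the case \<open>S = UNIV\<close> supplies the columns of a unitary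
  matrix.\<close>

lemma hermitian_orthonormal_eigenvectors:
  fixes A :: "complex^'n^'n" and S :: "'n set"
  assumes A: "hermitian A" and "finite S"
  shows "\<exists>v d. \<forall>i\<in>S. (\<forall>j\<in>S. cinner (v i) (v j) = (if i = j then 1 else 0)) \<and>
    A *v v i = complex_of_real (d i) *s v i"
  using \<open>finite S\<close>
proof (induction S)
  case (insert i S)
  then obtain v d where vd: "\<And>j k. j \<in> S \<Longrightarrow> k \<in> S \<Longrightarrow> cinner (v j) (v k) = (if j = k then 1 else 0)"
    "\<And>j. j \<in> S \<Longrightarrow> A *v v j = complex_of_real (d j) *s v j"
    by blast
  obtain w l where w: "w \<bullet> w = 1" "\<And>j. j \<in> S \<Longrightarrow> cinner (v j) w = 0"
    "A *v w = complex_of_real l *s w"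
    using hermitian_eigenvector_orthogonal[of A S v d i, OF A vd(2) insert.hyps(2)] by blast
  have cw: "cinner w w = 1"
  proof -
    have "Im (cinner w w) = 0" by (simp add: cinner_def mult.commute)
    then show ?thesis using w(1) by (simp add: complex_eq_iff inner_eq_Re_cinner)
  qed
  have "cinner w x = cnj (cinner x w)" for x
    by (simp add: cinner_def mult.commute)
  then have w': "cinner w (v j) = 0" if "j \<in> S" for j
    using w(2)[OF that] by simp
  show ?case
    using insert.hyps(2) vd w cw w'
    by (intro exI[of _ "v(i := w)"] exI[of _ "d(i := l)"]) auto
qed simp

lemma spectral_theorem:
  fixes A :: "complex^'n^'n"
  assumes "hermitian A"
  obtains U :: "complex^'n^'n" and d where "adj U ** U = mat 1" "U ** adj U = mat 1" "A = U ** diag d ** adj U"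
proof -
  obtain v :: "'n \<Rightarrow> complex^'n" and d where "\<forall>i. (\<forall>j. cinner (v i) (v j) = (if i = j then 1 else 0)) \<and>
      A *v v i = complex_of_real (d i) *s v i"
    using hermitian_orthonormal_eigenvectors[OF assms finite_class.finite_UNIV] by auto
  then have vd: "\<And>i j. cinner (v i) (v j) = (if i = j then 1 else 0)"
    "\<And>i. A *v v i = complex_of_real (d i) *s v i"
    by auto
  define U where "U = (\<chi> i j. v j $ i)"
  have U: "adj U ** U = mat 1"
    using vd(1) by (simp add: vec_eq_iff U_def matrix_matrix_mult_def mat_def cinner_def)
  then have U': "U ** adj U = mat 1"
    by (simp add: matrix_left_right_inverse)
  have "(A ** U) $ i $ j = (U ** diag d) $ i $ j" for i j
  proof -
    have "(A ** U) $ i $ j = (A *v v j) $ i"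
      by (simp add: matrix_matrix_mult_def matrix_vector_mult_def U_def)
    also have "\<dots> = (U ** diag d) $ i $ j"
      by (simp add: vd(2) matrix_matrix_mult_def diag_def U_def if_distrib mult.commute cong: if_cong)
    finally show ?thesis .
  qed
  then have "A ** U = U ** diag d" by (simp add: vec_eq_iff)
  then have "A = U ** diag d ** adj U"
    by (metis U' matrix_mul_assoc matrix_mul_rid)
  with U U' that show ?thesis by blast
qed

section \<open>Positive definite matrices\<close>

text \<open>The closed counterpart of \<open>pos_def\<close>: compactness needs closed conditions,
  and definiteness is recovered afterwards from the determinant.\<close>

definition pos_semidef :: "complex^'n^'n \<Rightarrow> bool" where
  "pos_semidef A \<longleftrightarrow> hermitian A \<and> (\<forall>x. 0 \<le> x \<bullet> (A *v x))"

lemma pos_def_iff: "pos_def A \<longleftrightarrow> hermitian A \<and> (\<forall>x. x \<noteq> 0 \<longrightarrow> 0 < x \<bullet> (A *v x))"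
  for A :: "complex^'n^'n"
proof -
  have "(\<Sum>i\<in>UNIV. \<Sum>j\<in>UNIV. cnj (x $ i) * A $ i $ j * x $ j) = cinner x (A *v x)" for x
    by (simp add: cinner_def matrix_vector_mult_def sum_distrib_left mult.assoc)
  then show ?thesis
    by (simp only: pos_def_def inner_eq_Re_cinner)
qed

lemma pos_def_imp_hermitian: "pos_def A \<Longrightarrow> hermitian A"
  by (simp add: pos_def_def)

lemma pos_def_imp_pos_semidef: "pos_def A \<Longrightarrow> pos_semidef A"
  by (metis inner_zero_left less_eq_real_def pos_def_iff pos_semidef_def)

lemma diag_mult_nth: "(diag d ** A) $ i $ j = of_real (d i) * A $ i $ j"
  by (simp add: matrix_matrix_mult_def diag_def if_distrib[of "\<lambda>x. x * _"] cong: if_cong)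

lemma diag_mult: "diag d ** diag e = diag (\<lambda>i. d i * e i)"
  by (simp add: vec_eq_iff diag_mult_nth) (simp add: diag_def)

lemma diag_const: "diag (\<lambda>i. c) = c *\<^sub>R mat 1"
  by (simp add: vec_eq_iff diag_def mat_def of_real_def)

lemma diag_eq_iff: "diag d = diag e \<longleftrightarrow> (\<forall>i. d i = e i)"
proof
  assume "diag d = diag e"
  then have "diag d $ i $ i = diag e $ i $ i" for i by simp
  then show "\<forall>i. d i = e i" by (simp add: diag_def)
qed (simp add: vec_eq_iff diag_def)

lemma det_diag: "det (diag d) = of_real (\<Prod>i\<in>UNIV. d i)"
  by (subst det_diagonal) (simp_all add: diag_def)

lemma inner_diag_mat_1: "diag d \<bullet> mat 1 = (\<Sum>i\<in>UNIV. d i)"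
proof -
  have "diag d $ i $ j \<bullet> mat 1 $ i $ j = (if j = i then d i else 0)" for i j
    by (simp add: diag_def mat_def inner_complex_def)
  then show ?thesis by (simp add: inner_vec_def)
qed

lemma diag_mult_vec_nth: "(diag d *v x) $ i = of_real (d i) * x $ i"
  by (simp add: diag_def matrix_vector_mult_def if_distrib[of "\<lambda>x. x * _"] cong: if_cong)

lemma form_diag: "x \<bullet> (diag d *v x) = (\<Sum>i\<in>UNIV. d i * (norm (x $ i))^2)"
proof -
  have "x $ i \<bullet> (of_real (d i) * x $ i) = d i * (norm (x $ i))^2" for i
    by (simp add: flip: scaleR_conv_of_real dot_square_norm)
  then show ?thesis by (simp add: inner_vec_def diag_mult_vec_nth)
qed

lemma form_diag_axis: "axis i 1 \<bullet> (diag d *v axis i 1) = d i"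
proof -
  have "d j * (norm ((axis i 1 :: complex^'a) $ j))^2 = (if j = i then d i else 0)" for j
    by (simp add: axis_def)
  then show ?thesis by (simp add: form_diag)
qed

lemma pos_semidef_spectral:
  fixes A :: "complex^'n^'n"
  assumes "pos_semidef A"
  obtains U :: "complex^'n^'n" and d where "adj U ** U = mat 1" "U ** adj U = mat 1" "A = U ** diag d ** adj U"
    "\<And>i. 0 \<le> d i"
proof -
  obtain U :: "complex^'n^'n" and d where U: "adj U ** U = mat 1" "U ** adj U = mat 1" and A: "A = U ** diag d ** adj U"
    using spectral_theorem assms unfolding pos_semidef_def by blast
  have "diag d = adj U ** A ** U"
    unfolding A using U by (metis matrix_mul_assoc matrix_mul_lid matrix_mul_rid)
  then have "d i = (U *v axis i 1) \<bullet> (A *v (U *v axis i 1))" for i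
    using form_diag_axis[of i d] by (simp add: form_congruence)
  then have "0 \<le> d i" for i using assms by (simp add: pos_semidef_def)
  with U A that show ?thesis by blast
qed

lemma det_unitary_conj:
  fixes U :: "complex^'n^'n"
  assumes "U ** adj U = mat 1"
  shows "det (U ** diag d ** adj U) = of_real (\<Prod>i\<in>UNIV. d i)"
proof -
  have "det U * det (adj U) = 1"
    using assms by (simp flip: det_mul)
  then show ?thesis
    by (simp add: det_mul det_diag mult.commute mult.left_commute)
qed

text \<open>The determinant is the product of the nonnegative eigenvalues, so its positivity
  excludes the eigenvalue zero.\<close>

lemma pos_semidef_pos_def:
  fixes A :: "complex^'n^'n"
  assumes A: "pos_semidef A" and "0 < Re (det A)"
  shows "pos_def A"
proof -
  obtain U :: "complex^'n^'n" and d where U: "adj U ** U = mat 1" "U ** adj U = mat 1" and AU: "A = U ** diag d ** adj U"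
    and d: "\<And>i. 0 \<le> d i"
    using pos_semidef_spectral[OF A] by blast
  have "det A = of_real (\<Prod>i\<in>UNIV. d i)"
    unfolding AU by (rule det_unitary_conj[OF U(2)])
  then have "(\<Prod>i\<in>UNIV. d i) \<noteq> 0"
    using \<open>0 < Re (det A)\<close> by (metis Re_complex_of_real less_irrefl)
  then have d: "0 < d i" for i
    using d[of i] by (auto simp: less_le)
  have "0 < x \<bullet> (A *v x)" if "x \<noteq> 0" for x
  proof -
    define y where "y = adj U *v x"
    have "U *v y = x" by (simp add: y_def matrix_vector_mul_assoc U)
    then have "y \<noteq> 0" using that by auto
    then obtain i where "y $ i \<noteq> 0" by (auto simp: vec_eq_iff)
    then have "0 < y \<bullet> (diag d *v y)"
      unfolding form_diag using d
      by (intro sum_pos2[of _ i]) (auto intro!: mult_nonneg_nonneg less_imp_le[OF d])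
    then show ?thesis
      using form_congruence[of x "adj U" "diag d"] by (simp add: AU y_def)
  qed
  with A show ?thesis by (simp add: pos_def_iff pos_semidef_def)
qed

lemma pos_def_spectral:
  fixes A :: "complex^'n^'n"
  assumes A: "pos_def A"
  obtains U :: "complex^'n^'n" and d where "adj U ** U = mat 1" "U ** adj U = mat 1" "A = U ** diag d ** adj U"
    "\<And>i. 0 < d i"
proof -
  obtain U :: "complex^'n^'n" and d where U: "adj U ** U = mat 1" "U ** adj U = mat 1" and AU: "A = U ** diag d ** adj U"
    and d: "\<And>i. 0 \<le> d i"
    using pos_semidef_spectral[OF pos_def_imp_pos_semidef[OF A]] by blast
  have "d i \<noteq> 0" for i
  proof
    assume "d i = 0"
    define x where "x = U *v axis i 1"
    have e: "adj U *v x = axis i 1"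
      by (simp add: x_def matrix_vector_mul_assoc U)
    then have "x \<noteq> 0" by (auto simp: axis_eq_0_iff)
    moreover have "x \<bullet> (A *v x) = d i"
      using form_congruence[of x "adj U" "diag d"] form_diag_axis[of i d] by (simp add: AU e)
    ultimately show False
      using A \<open>d i = 0\<close> by (auto simp: pos_def_iff)
  qed
  with U AU d that show ?thesis by (metis less_le)
qed

lemma pos_def_det:
  fixes A :: "complex^'n^'n"
  assumes A: "pos_def A"
  shows "0 < Re (det A)" "det A = of_real (Re (det A))"
proof -
  obtain U :: "complex^'n^'n" and d where U: "U ** adj U = mat 1" and AU: "A = U ** diag d ** adj U"
    and d: "\<And>i. 0 < d i"
    using pos_def_spectral[OF A] by blast
  have "det A = of_real (\<Prod>i\<in>UNIV. d i)"
    unfolding AU by (rule det_unitary_conj[OF U])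
  moreover have "0 < (\<Prod>i\<in>UNIV. d i)" by (intro prod_pos) (simp add: d)
  ultimately show "0 < Re (det A)" "det A = of_real (Re (det A))"
    by (simp_all del: of_real_prod)
qed

text \<open>The unitary times the square roots of the eigenvalues is enough for \<open>S\<close>; it
  need not be Hermitian. The explicit inverse \<open>R\<close> lets later congruences be
  undone.\<close>

lemma pos_def_factor:
  fixes A :: "complex^'n^'n"
  assumes A: "pos_def A"
  obtains S R :: "complex^'n^'n" where "A = S ** adj S" "S ** R = mat 1" "R ** S = mat 1"
proof -
  obtain U :: "complex^'n^'n" and d where U: "adj U ** U = mat 1" "U ** adj U = mat 1" and AU: "A = U ** diag d ** adj U"
    and d: "\<And>i. 0 < d i"
    using pos_def_spectral[OF A] by blast
  define S where "S = U ** diag (\<lambda>i. sqrt (d i))"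
  define R where "R = diag (\<lambda>i. 1 / sqrt (d i)) ** adj U"
  have pos: "0 \<le> d i" "d i \<noteq> 0" for i using d[of i] by auto
  have "S ** adj S = U ** (diag (\<lambda>i. sqrt (d i)) ** diag (\<lambda>i. sqrt (d i))) ** adj U"
    by (simp add: S_def adj_mult matrix_mul_assoc)
  then have "A = S ** adj S"
    by (simp add: AU diag_mult pos)
  moreover have "R ** S = mat 1"
  proof -
    have "R ** S = diag (\<lambda>i. 1 / sqrt (d i)) ** (adj U ** U) ** diag (\<lambda>i. sqrt (d i))"
      by (simp add: R_def S_def matrix_mul_assoc)
    then show ?thesis by (simp add: U diag_mult pos diag_const)
  qed
  moreover from this have "S ** R = mat 1" by (simp add: matrix_left_right_inverse)
  ultimately show ?thesis using that by blast
qed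

lemma pos_def_congruence:
  fixes A T L :: "complex^'n^'n"
  assumes A: "pos_def A" and L: "L ** T = mat 1"
  shows "pos_def (adj T ** A ** T)"
  unfolding pos_def_iff
proof (intro conjI allI impI)
  show "hermitian (adj T ** A ** T)"
    using A by (intro hermitian_congruence pos_def_imp_hermitian)
  fix x :: "complex^'n" assume "x \<noteq> 0"
  have "L *v (T *v x) = x" by (simp add: matrix_vector_mul_assoc L)
  then have "T *v x \<noteq> 0" using \<open>x \<noteq> 0\<close> by auto
  then show "0 < x \<bullet> ((adj T ** A ** T) *v x)"
    using A by (simp add: form_congruence pos_def_iff)
qed

lemma pos_def_mat_1: "pos_def (mat 1 :: complex^'n^'n)"
  by (simp add: pos_def_iff hermitian_iff_adj)

lemma pos_def_inverse:
  fixes A :: "complex^'n^'n"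
  assumes "pos_def A"
  obtains N where "pos_def N" "A ** N = mat 1" "N ** A = mat 1"
proof -
  obtain S R :: "complex^'n^'n" where SR: "A = S ** adj S" "S ** R = mat 1" "R ** S = mat 1"
    by (rule pos_def_factor[OF assms])
  have SR': "adj S ** adj R = mat 1"
    using SR(3) by (metis adj_mat_1 adj_mult)
  have "pos_def (adj R ** R)"
    using pos_def_congruence[OF pos_def_mat_1 SR(2)] by simp
  moreover have "A ** (adj R ** R) = S ** (adj S ** adj R) ** R"
    by (simp add: SR(1) matrix_mul_assoc)
  then have "A ** (adj R ** R) = mat 1"
    by (simp add: SR(2) SR')
  ultimately show ?thesis using that by (simp add: matrix_left_right_inverse)
qed

lemma pos_def_add: "pos_def A \<Longrightarrow> pos_def B \<Longrightarrow> pos_def (A + B)"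
  by (auto simp: pos_def_iff hermitian_iff_adj adj_add matrix_vector_mult_add_rdistrib inner_add_right
      intro: add_pos_pos)

lemma scaleR_matrix_vector: "(r *\<^sub>R A) *v x = r *\<^sub>R (A *v x)" for A :: "complex^'n^'m"
  by (simp add: vec_eq_iff matrix_vector_mult_def scaleR_sum_right)

lemma pos_def_scaleR: "0 < r \<Longrightarrow> pos_def A \<Longrightarrow> pos_def (r *\<^sub>R A)"
  by (auto simp: pos_def_iff hermitian_iff_adj adj_scaleR scaleR_matrix_vector)

lemma pos_def_convex_combination:
  fixes A B :: "complex^'n^'n"
  assumes "pos_def A" "pos_def B" "0 \<le> u" "0 \<le> v" "u + v = (1::real)"
  shows "pos_def (u *\<^sub>R A + v *\<^sub>R B)"
proof (cases "u = 0 \<or> v = 0")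
  case True
  then show ?thesis using assms by auto
next
  case False
  then show ?thesis using assms by (intro pos_def_add pos_def_scaleR) auto
qed

lemma matrix_inv_eq:
  fixes A :: "complex^'n^'n"
  assumes "A ** B = mat 1"
  shows "matrix_inv A = B"
proof -
  have "B ** A = mat 1" using assms by (simp add: matrix_left_right_inverse)
  with assms have "A ** B = mat 1 \<and> B ** A = mat 1" by simp
  then have inv: "A ** matrix_inv A = mat 1 \<and> matrix_inv A ** A = mat 1"
    unfolding matrix_inv_def by (rule someI)
  have "matrix_inv A = (B ** A) ** matrix_inv A"
    by (simp add: \<open>B ** A = mat 1\<close>)
  also have "\<dots> = B ** (A ** matrix_inv A)" by (rule matrix_mul_assoc[symmetric])
  finally show ?thesis by (simp add: inv)
qed

section \<open>Trace and log-determinant of positive definite matrices\<close>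

text \<open>The values \<open>m i\<close> are the eigenvalues of \<open>adj S ** M ** S\<close>, where \<open>\<rho> = S ** adj S\<close>.\<close>
lemma pos_def_pair_eigenvalues:
  fixes M \<rho> :: "complex^'n^'n"
  assumes M: "pos_def M" and \<rho>: "pos_def \<rho>"
  obtains m :: "'n \<Rightarrow> real" where "\<And>i. 0 < m i" "M \<bullet> \<rho> = (\<Sum>i\<in>UNIV. m i)"
    "ln (Re (det M)) + ln (Re (det \<rho>)) = (\<Sum>i\<in>UNIV. ln (m i))"
    "\<And>c. M ** \<rho> = c *\<^sub>R mat 1 \<longleftrightarrow> (\<forall>i. m i = c)"
proof -
  obtain S R :: "complex^'n^'n" where SR: "\<rho> = S ** adj S" "S ** R = mat 1" "R ** S = mat 1"
    by (rule pos_def_factor[OF \<rho>])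
  have SR': "adj R ** adj S = mat 1"
    using SR(2) by (metis adj_mat_1 adj_mult)
  have SR'': "adj S ** adj R = mat 1"
    using SR(3) by (metis adj_mat_1 adj_mult)
  define P where "P = adj S ** M ** S"
  have "pos_def P"
    unfolding P_def by (rule pos_def_congruence[OF M SR(3)])
  then obtain V :: "complex^'n^'n" and m where V: "adj V ** V = mat 1" "V ** adj V = mat 1"
    and P: "P = V ** diag m ** adj V" and m: "\<And>i. 0 < m i"
    using pos_def_spectral by blast
  have "M \<bullet> \<rho> = P \<bullet> mat 1"
    by (simp add: P_def inner_congruence SR(1))
  also have "\<dots> = diag m \<bullet> mat 1"
    using inner_congruence[of "adj V" "diag m" "mat 1"] by (simp add: P V)
  finally have tr: "M \<bullet> \<rho> = (\<Sum>i\<in>UNIV. m i)"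
    by (simp add: inner_diag_mat_1)
  have "det M * det \<rho> = det P"
    by (simp add: P_def SR(1) det_mul)
  also have "\<dots> = of_real (\<Prod>i\<in>UNIV. m i)"
    unfolding P by (rule det_unitary_conj[OF V(2)])
  finally have "complex_of_real (Re (det M) * Re (det \<rho>)) = of_real (\<Prod>i\<in>UNIV. m i)"
    using pos_def_det(2)[OF M] pos_def_det(2)[OF \<rho>] by simp
  then have "Re (det M) * Re (det \<rho>) = (\<Prod>i\<in>UNIV. m i)"
    by (simp only: of_real_eq_iff)
  then have "ln (Re (det M)) + ln (Re (det \<rho>)) = ln (\<Prod>i\<in>UNIV. m i)"
    using pos_def_det(1)[OF M] pos_def_det(1)[OF \<rho>] by (metis ln_mult_pos)
  also have "\<dots> = (\<Sum>i\<in>UNIV. ln (m i))"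
    by (intro ln_prod) (auto simp: less_imp_neq[OF m, symmetric])
  finally have det: "ln (Re (det M)) + ln (Re (det \<rho>)) = (\<Sum>i\<in>UNIV. ln (m i))" .
  have inv: "M ** \<rho> = c *\<^sub>R mat 1 \<longleftrightarrow> (\<forall>i. m i = c)" for c
  proof -
    \<comment> \<open>\<open>M ** \<rho>\<close> equals \<open>adj R ** P ** adj S\<close>, where
      \<open>adj R\<close> and \<open>adj S\<close> are mutually inverse. So it is similar to
      \<open>P\<close>, and each is the scalar \<open>c\<close> exactly when the other is.\<close>
    have "M ** \<rho> = c *\<^sub>R mat 1 \<longleftrightarrow> P = c *\<^sub>R mat 1"
    proof
      assume Mr: "M ** \<rho> = c *\<^sub>R mat 1"
      have "M ** \<rho> = (adj R ** adj S) ** M ** S ** adj S"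
        by (simp add: SR' SR(1) matrix_mul_assoc)
      then have *: "adj R ** P ** adj S = c *\<^sub>R mat 1"
        using Mr by (simp add: P_def matrix_mul_assoc)
      have "P = (adj S ** adj R) ** P ** (adj S ** adj R)"
        by (simp add: SR'')
      also have "\<dots> = adj S ** (adj R ** P ** adj S) ** adj R"
        by (simp add: matrix_mul_assoc)
      also have "\<dots> = c *\<^sub>R mat 1"
        by (simp add: * SR'' matrix_scalar_ac flip: scalar_matrix_assoc)
      finally show "P = c *\<^sub>R mat 1" .
    next
      assume P: "P = c *\<^sub>R mat 1"
      have "M ** \<rho> = (adj R ** adj S) ** M ** S ** adj S"
        by (simp add: SR' SR(1) matrix_mul_assoc)
      also have "\<dots> = adj R ** P ** adj S"
        by (simp add: P_def matrix_mul_assoc)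
      also have "\<dots> = c *\<^sub>R mat 1"
        by (simp add: P SR' matrix_scalar_ac flip: scalar_matrix_assoc)
      finally show "M ** \<rho> = c *\<^sub>R mat 1" .
    qed
    also have "\<dots> \<longleftrightarrow> diag m = diag (\<lambda>i. c)"
    proof
      assume "P = c *\<^sub>R mat 1"
      have "diag m = (adj V ** V) ** diag m ** (adj V ** V)" by (simp add: V)
      also have "\<dots> = adj V ** P ** V" by (simp add: P matrix_mul_assoc)
      also have "\<dots> = c *\<^sub>R mat 1"
        by (simp add: \<open>P = c *\<^sub>R mat 1\<close> V matrix_scalar_ac flip: scalar_matrix_assoc)
      finally show "diag m = diag (\<lambda>i. c)" by (simp add: diag_const)
    next
      assume "diag m = diag (\<lambda>i. c)"
      then show "P = c *\<^sub>R mat 1"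
        by (simp add: P diag_const V matrix_scalar_ac flip: scalar_matrix_assoc)
    qed
    finally show ?thesis by (simp add: diag_eq_iff)
  qed
  show ?thesis using that[OF m tr det inv] .
qed

text \<open>Eigenvalue by eigenvalue this is \<open>ln x \<le> x - 1\<close> at
  \<open>x = m i / \<epsilon>\<close>, with equality only at \<open>x = 1\<close>; the constant
  \<open>\<epsilon> * (1 - ln \<epsilon>)\<close> is the minimum of
  \<open>m - \<epsilon> * ln m\<close> over positive \<open>m\<close>.\<close>

lemma trace_ln_det_gap:
  fixes M \<rho> :: "complex^'n^'n"
  assumes M: "pos_def M" and \<rho>: "pos_def \<rho>" and "0 < \<epsilon>"
  defines "gap \<equiv> M \<bullet> \<rho> - \<epsilon> * ln (Re (det \<rho>)) - \<epsilon> * ln (Re (det M))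
    - real CARD('n) * \<epsilon> * (1 - ln \<epsilon>)"
  shows "0 \<le> gap" "gap = 0 \<longleftrightarrow> M ** \<rho> = \<epsilon> *\<^sub>R mat 1"
proof -
  obtain m :: "'n \<Rightarrow> real" where m: "\<And>i. 0 < m i" and tr: "M \<bullet> \<rho> = (\<Sum>i\<in>UNIV. m i)"
    and det: "ln (Re (det M)) + ln (Re (det \<rho>)) = (\<Sum>i\<in>UNIV. ln (m i))"
    and inv: "\<And>c. M ** \<rho> = c *\<^sub>R mat 1 \<longleftrightarrow> (\<forall>i. m i = c)"
    using pos_def_pair_eigenvalues[OF M \<rho>] by blast
  define g where "g i = \<epsilon> * (m i / \<epsilon> - 1 - ln (m i / \<epsilon>))" for i
  have g_eq: "g i = m i - \<epsilon> * ln (m i) - \<epsilon> * (1 - ln \<epsilon>)" for i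
    using m[of i] \<open>0 < \<epsilon>\<close> by (simp add: g_def ln_div algebra_simps)
  have "gap = (\<Sum>i\<in>UNIV. m i) - \<epsilon> * (ln (Re (det M)) + ln (Re (det \<rho>)))
      - real CARD('n) * \<epsilon> * (1 - ln \<epsilon>)"
    by (simp add: gap_def tr algebra_simps)
  also have "\<dots> = (\<Sum>i\<in>UNIV. g i)"
    by (simp add: det g_eq sum_subtractf sum_distrib_left)
  finally have gap: "gap = (\<Sum>i\<in>UNIV. g i)" .
  have g_nonneg: "0 \<le> g i" for i
    using m[of i] \<open>0 < \<epsilon>\<close> ln_le_minus_one[of "m i / \<epsilon>"] by (simp add: g_def)
  have g_zero: "g i = 0 \<longleftrightarrow> m i = \<epsilon>" for i
    using m[of i] \<open>0 < \<epsilon>\<close> ln_eq_minus_one[of "m i / \<epsilon>"] by (auto simp: g_def)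
  show "0 \<le> gap" unfolding gap by (intro sum_nonneg g_nonneg)
  show "gap = 0 \<longleftrightarrow> M ** \<rho> = \<epsilon> *\<^sub>R mat 1"
    unfolding gap inv by (subst sum_nonneg_eq_0_iff) (auto simp: g_nonneg g_zero)
qed

text \<open>With \<open>N\<close> the inverse of \<open>M\<close>, the gap says that
  \<open>ln det\<close> lies below its tangent at \<open>M\<close>. Averaging the gaps at
  \<open>A\<close> and \<open>B\<close> gives the Jensen defect. A zero gap at \<open>A\<close>
  would force \<open>A = M\<close>, hence \<open>A = B\<close> when both weights are
  positive.\<close>

lemma ln_det_concave:
  fixes A B :: "complex^'n^'n"
  assumes A: "pos_def A" and B: "pos_def B" and uv: "0 \<le> u" "0 \<le> v" "u + v = 1"
  defines "M \<equiv> u *\<^sub>R A + v *\<^sub>R B"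
  shows "u * ln (Re (det A)) + v * ln (Re (det B)) \<le> ln (Re (det M))"
    and "0 < u \<Longrightarrow> 0 < v \<Longrightarrow> A \<noteq> B \<Longrightarrow>
      u * ln (Re (det A)) + v * ln (Re (det B)) < ln (Re (det M))"
proof -
  have M: "pos_def M"
    unfolding M_def using A B uv by (rule pos_def_convex_combination)
  obtain N where N: "pos_def N" "M ** N = mat 1" "N ** M = mat 1"
    by (rule pos_def_inverse[OF M])
  define G where "G X = X \<bullet> N - ln (Re (det N)) - ln (Re (det X)) - real CARD('n)" for X
  have nonneg: "0 \<le> G X" and zero: "G X = 0 \<longleftrightarrow> X ** N = mat 1" if "pos_def X" for X
    using trace_ln_det_gap[OF that N(1), of 1] by (simp_all add: G_def)
  have "G M = 0" using zero[OF M] N(2) by simp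
  \<comment> \<open>Subtracting \<open>G M = 0\<close> cancels the trace terms by linearity; besides
    the defect only a multiple of \<open>u + v - 1\<close> remains.\<close>
  have "u * G A + v * G B = u * G A + v * G B - G M"
    by (simp add: \<open>G M = 0\<close>)
  also have "\<dots> = ln (Re (det M)) - (u * ln (Re (det A)) + v * ln (Re (det B)))
      - (u + v - 1) * (ln (Re (det N)) + real CARD('n))"
    by (simp add: G_def M_def inner_add_left algebra_simps)
  finally have eq: "u * G A + v * G B
      = ln (Re (det M)) - (u * ln (Re (det A)) + v * ln (Re (det B)))"
    using uv by simp
  moreover have "0 \<le> u * G A" "0 \<le> v * G B"
    using uv nonneg[OF A] nonneg[OF B] by simp_all
  ultimately show "u * ln (Re (det A)) + v * ln (Re (det B)) \<le> ln (Re (det M))"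
    by linarith
  assume uv': "0 < u" "0 < v" and "A \<noteq> B"
  have "G A \<noteq> 0"
  proof
    assume "G A = 0"
    then have "A ** N = mat 1" using zero[OF A] by simp
    then have "A = M"
      by (metis N(3) matrix_mul_assoc matrix_mul_lid matrix_mul_rid)
    then have "v *\<^sub>R B = (1 - u) *\<^sub>R A" by (simp add: M_def algebra_simps)
    also have "1 - u = v" using uv by simp
    finally show False using uv' \<open>A \<noteq> B\<close> by simp
  qed
  then have "0 < u * G A" using nonneg[OF A] uv' by simp
  then show "u * ln (Re (det A)) + v * ln (Re (det B)) < ln (Re (det M))"
    using eq \<open>0 \<le> v * G B\<close> by linarith
qed

text \<open>A common congruence, not a similarity: if \<open>S\<close> factors \<open>\<rho>\<close>
  with inverse \<open>R\<close>, and the unitary \<open>V\<close> diagonalises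
  \<open>R ** Z ** adj R\<close>, then \<open>T = S ** V\<close> works.\<close>

lemma simultaneous_diagonalization:
  fixes \<rho> Z :: "complex^'n^'n"
  assumes "pos_def \<rho>" and "hermitian Z"
  obtains T L :: "complex^'n^'n" and k where "L ** T = mat 1" "\<rho> = T ** adj T" "Z = T ** diag k ** adj T"
proof -
  obtain S R :: "complex^'n^'n" where SR: "\<rho> = S ** adj S" "S ** R = mat 1" "R ** S = mat 1"
    by (rule pos_def_factor[OF assms(1)])
  have SR': "adj R ** adj S = mat 1"
    using SR(2) by (metis adj_mat_1 adj_mult)
  have "hermitian (R ** Z ** adj R)"
    using hermitian_congruence[OF assms(2), of "adj R"] by simp
  then obtain V :: "complex^'n^'n" and k where V: "adj V ** V = mat 1" "V ** adj V = mat 1"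
    and K: "R ** Z ** adj R = V ** diag k ** adj V"
    using spectral_theorem by blast
  have "(adj V ** R) ** (S ** V) = adj V ** (R ** S) ** V"
    by (simp add: matrix_mul_assoc)
  then have 1: "(adj V ** R) ** (S ** V) = mat 1" by (simp add: SR V)
  have "(S ** V) ** adj (S ** V) = S ** (V ** adj V) ** adj S"
    by (simp add: adj_mult matrix_mul_assoc)
  then have 2: "\<rho> = (S ** V) ** adj (S ** V)" by (simp add: SR(1) V)
  have "Z = (S ** R) ** Z ** (adj R ** adj S)" by (simp add: SR SR')
  also have "\<dots> = S ** (R ** Z ** adj R) ** adj S" by (simp add: matrix_mul_assoc)
  finally have "Z = (S ** V) ** diag k ** adj (S ** V)"
    by (simp add: K adj_mult matrix_mul_assoc)
  with 1 2 that show ?thesis by blast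
qed

lemma matrix_mult_add_left: "(A + B) ** C = A ** C + B ** C"
  for A B :: "complex^'n^'m"
  by (simp add: vec_eq_iff matrix_matrix_mult_def sum.distrib distrib_right)

text \<open>Under a common congruence, \<open>det (\<rho> + t *\<^sub>R Z)\<close> is
  \<open>det \<rho>\<close> times the product of the \<open>1 + t * k i\<close>, and the
  \<open>k i\<close> sum to \<open>Z \<bullet> N\<close>. The claim becomes the vanishing derivative
  of a function of one real variable at a local minimum.\<close>

lemma ln_det_line_minimum:
  fixes \<rho> Z W N :: "complex^'n^'n"
  assumes \<rho>: "pos_def \<rho>" and N: "\<rho> ** N = mat 1" and Z: "hermitian Z"
    and min: "\<And>t. pos_def (\<rho> + t *\<^sub>R Z) \<Longrightarrow>
      W \<bullet> \<rho> - \<epsilon> * ln (Re (det \<rho>)) \<le> W \<bullet> (\<rho> + t *\<^sub>R Z) - \<epsilon> * ln (Re (det (\<rho> + t *\<^sub>R Z)))"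
  shows "W \<bullet> Z = \<epsilon> * (Z \<bullet> N)"
proof -
  obtain T L :: "complex^'n^'n" and k where L: "L ** T = mat 1" and \<rho>T: "\<rho> = T ** adj T"
    and ZT: "Z = T ** diag k ** adj T"
    by (rule simultaneous_diagonalization[OF \<rho> Z])
  have "adj T ** N ** T = (L ** T) ** (adj T ** N ** T)" by (simp add: L)
  also have "\<dots> = L ** (\<rho> ** N) ** T" by (simp add: \<rho>T matrix_mul_assoc)
  finally have TNT: "adj T ** N ** T = mat 1" by (simp add: N L)
  have ZN: "Z \<bullet> N = (\<Sum>i\<in>UNIV. k i)"
    using inner_congruence[of "adj T" "diag k" N] by (simp add: ZT TNT inner_diag_mat_1)
  have line: "\<rho> + t *\<^sub>R Z = T ** diag (\<lambda>i. 1 + t * k i) ** adj T" for t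
  proof -
    have "diag (\<lambda>i. 1 + t * k i) = mat 1 + t *\<^sub>R diag k"
      by (simp add: vec_eq_iff diag_def mat_def of_real_def algebra_simps)
    then show ?thesis
      by (simp add: \<rho>T ZT matrix_add_ldistrib matrix_mult_add_left matrix_scalar_ac
          flip: scalar_matrix_assoc)
  qed
  have det_line: "det (\<rho> + t *\<^sub>R Z) = det \<rho> * of_real (\<Prod>i\<in>UNIV. 1 + t * k i)" for t
    unfolding line by (simp add: \<rho>T det_mul det_diag)
  \<comment> \<open>\<open>h t\<close> is the change of the objective when moving from
    \<open>\<rho>\<close> to \<open>\<rho> + t *\<^sub>R Z\<close>.\<close>
  define h where "h t = t * (W \<bullet> Z) - \<epsilon> * (\<Sum>i\<in>UNIV. ln (1 + t * k i))" for t
  \<comment> \<open>Within this radius every \<open>t * k i\<close> has absolute value below 1, so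
    the line stays positive definite. The added 1 covers the case where all \<open>k i\<close>
    vanish.\<close>
  define \<delta> where "\<delta> = 1 / (1 + (\<Sum>i\<in>UNIV. \<bar>k i\<bar>))"
  have K: "0 \<le> (\<Sum>i\<in>UNIV. \<bar>k i\<bar>)" by (intro sum_nonneg) auto
  then have K1: "0 < 1 + (\<Sum>i\<in>UNIV. \<bar>k i\<bar>)" by linarith
  then have "0 < \<delta>" by (simp add: \<delta>_def)
  have "h 0 \<le> h t" if "\<bar>0 - t\<bar> < \<delta>" for t
  proof -
    have pos: "0 < 1 + t * k i" for i
    proof -
      have "\<bar>k i\<bar> \<le> (\<Sum>i\<in>UNIV. \<bar>k i\<bar>)" by (rule member_le_sum) auto
      then have "\<bar>t * k i\<bar> \<le> \<bar>t\<bar> * (1 + (\<Sum>i\<in>UNIV. \<bar>k i\<bar>))"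
        by (simp add: abs_mult mult_left_mono)
      also have "\<dots> < 1"
        using that K1 by (simp add: \<delta>_def pos_less_divide_eq)
      finally show ?thesis by linarith
    qed
    have prod_pos: "0 < (\<Prod>i\<in>UNIV. 1 + t * k i)" by (intro prod_pos pos)
    have "pos_semidef (\<rho> + t *\<^sub>R Z)"
      unfolding pos_semidef_def
    proof (intro conjI allI)
      show "hermitian (\<rho> + t *\<^sub>R Z)"
        by (simp add: line hermitian_iff_adj adj_mult matrix_mul_assoc)
      show "0 \<le> x \<bullet> ((\<rho> + t *\<^sub>R Z) *v x)" for x
        using form_congruence[of x "adj T" "diag (\<lambda>i. 1 + t * k i)"]
        by (simp add: line form_diag sum_nonneg pos less_imp_le)
    qed
    moreover have Re_det: "Re (det (\<rho> + t *\<^sub>R Z)) = Re (det \<rho>) * (\<Prod>i\<in>UNIV. 1 + t * k i)"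
      by (simp add: det_line del: of_real_prod)
    ultimately have "pos_def (\<rho> + t *\<^sub>R Z)"
      using prod_pos pos_def_det(1)[OF \<rho>] by (intro pos_semidef_pos_def) auto
    then have "W \<bullet> \<rho> - \<epsilon> * ln (Re (det \<rho>)) \<le>
        W \<bullet> (\<rho> + t *\<^sub>R Z) - \<epsilon> * ln (Re (det (\<rho> + t *\<^sub>R Z)))"
      by (rule min)
    moreover have "ln (Re (det (\<rho> + t *\<^sub>R Z))) = ln (Re (det \<rho>)) + (\<Sum>i\<in>UNIV. ln (1 + t * k i))"
      unfolding Re_det using prod_pos pos_def_det(1)[OF \<rho>]
      by (simp add: ln_mult_pos ln_prod less_imp_neq[OF pos, symmetric])
    ultimately show ?thesis
      by (simp add: h_def inner_add_right algebra_simps)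
  qed
  moreover have "(h has_real_derivative (W \<bullet> Z - \<epsilon> * (\<Sum>i\<in>UNIV. k i))) (at 0)"
    unfolding h_def by (auto intro!: derivative_eq_intros)
  ultimately have "W \<bullet> Z - \<epsilon> * (\<Sum>i\<in>UNIV. k i) = 0"
    using DERIV_local_min[OF _ \<open>0 < \<delta>\<close>] by blast
  then show ?thesis by (simp add: ZN)
qed

section \<open>Kronecker products and partial traces\<close>

definition kron_sum :: "complex^'a^'a \<Rightarrow> complex^'b^'b \<Rightarrow> complex^('a \<times> 'b)^('a \<times> 'b)" where
  "kron_sum X Y = kron X (mat 1) + kron (mat 1) Y"

lemma CXY_eq: "CXY C X Y = C - kron_sum X Y"
  by (simp add: CXY_def kron_sum_def)

lemma sum_UNIV_prod: "(\<Sum>p\<in>UNIV. f p) = (\<Sum>i\<in>UNIV. \<Sum>j\<in>UNIV. f (i, j))"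
  for f :: "'a::finite \<times> 'b::finite \<Rightarrow> 'c::comm_monoid_add"
  by (simp add: sum.cartesian_product)

lemma kron_mult: "kron A B ** kron A' B' = kron (A ** A') (B ** B')"
proof -
  have "(kron A B ** kron A' B') $ p $ q = kron (A ** A') (B ** B') $ p $ q" for p q
  proof -
    have "(kron A B ** kron A' B') $ p $ q = (\<Sum>i\<in>UNIV. \<Sum>j\<in>UNIV.
        (A $ fst p $ i * A' $ i $ fst q) * (B $ snd p $ j * B' $ j $ snd q))"
      by (simp add: matrix_matrix_mult_def kron_def sum_UNIV_prod mult_ac)
    also have "\<dots> = kron (A ** A') (B ** B') $ p $ q"
      by (simp add: matrix_matrix_mult_def kron_def sum_product)
    finally show ?thesis .
  qed
  then show ?thesis by (simp add: vec_eq_iff)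
qed

lemma kron_mat_1: "kron (mat 1) (mat 1) = mat 1"
  by (auto simp: vec_eq_iff kron_def mat_def prod_eq_iff)

lemma adj_kron: "adj (kron A B) = kron (adj A) (adj B)"
  by (simp add: vec_eq_iff kron_def)

text \<open>Factors of \<open>A\<close> and \<open>B\<close> combine into a factor of the product,
  which is thus a congruence of the identity by an invertible matrix.\<close>

lemma pos_def_kron:
  fixes A :: "complex^'a^'a" and B :: "complex^'b^'b"
  assumes "pos_def A" "pos_def B"
  shows "pos_def (kron A B)"
proof -
  obtain S R :: "complex^'a^'a" where SR: "A = S ** adj S" "S ** R = mat 1" "R ** S = mat 1"
    by (rule pos_def_factor[OF assms(1)])
  obtain S' R' :: "complex^'b^'b" where SR': "B = S' ** adj S'" "S' ** R' = mat 1" "R' ** S' = mat 1"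
    by (rule pos_def_factor[OF assms(2)])
  have "kron S S' ** kron R R' = mat 1"
    by (simp add: kron_mult SR SR' kron_mat_1)
  then have "adj (kron R R') ** adj (kron S S') = mat 1"
    by (metis adj_mat_1 adj_mult)
  from pos_def_congruence[OF pos_def_mat_1 this]
  show ?thesis by (simp add: adj_kron kron_mult SR(1) SR'(1))
qed

section \<open>Partial traces and Kronecker sums\<close>

lemma ptr2_kron: "ptr2 (kron A B) = (\<chi> i j. A $ i $ j * trace B)"
  by (simp add: ptr2_def kron_def trace_def vec_eq_iff sum_distrib_left)

lemma ptr1_kron: "ptr1 (kron A B) = (\<chi> i j. trace A * B $ i $ j)"
  by (simp add: ptr1_def kron_def trace_def vec_eq_iff sum_distrib_right)

lemma ptr2_linear: "linear ptr2"
  by (rule linearI) (simp_all add: ptr2_def vec_eq_iff sum.distrib scaleR_sum_right)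

lemma ptr1_linear: "linear ptr1"
  by (rule linearI) (simp_all add: ptr1_def vec_eq_iff sum.distrib scaleR_sum_right)

lemma kron_sum_linear: "linear (\<lambda>(X, Y). kron_sum X Y)"
  by (rule linearI)
    (auto simp: kron_sum_def kron_def vec_eq_iff algebra_simps scaleR_add_right)

lemma kron_sum_diff: "kron_sum (X - X') (Y - Y') = kron_sum X Y - kron_sum X' Y'"
  using linear_diff[OF kron_sum_linear, of "(X, Y)" "(X', Y')"] by simp

lemma kron_sum_combination:
  "kron_sum (u *\<^sub>R X + v *\<^sub>R X') (u *\<^sub>R Y + v *\<^sub>R Y') = u *\<^sub>R kron_sum X Y + v *\<^sub>R kron_sum X' Y'"
  using linear_add[OF kron_sum_linear, of "u *\<^sub>R (X, Y)" "v *\<^sub>R (X', Y')"]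
    linear_scale[OF kron_sum_linear, of u "(X, Y)"] linear_scale[OF kron_sum_linear, of v "(X', Y')"]
  by simp

lemma trace_ptr2: "trace (ptr2 \<rho>) = trace \<rho>"
  by (simp add: trace_def ptr2_def sum_UNIV_prod)

lemma trace_ptr1: "trace (ptr1 \<rho>) = trace \<rho>"
  by (simp add: trace_def ptr1_def sum_UNIV_prod) (rule sum.swap)

lemma ptr2_kron_sum:
  "ptr2 (kron_sum X Y) = real CARD('b) *\<^sub>R X + mat (trace Y)"
  for X :: "complex^'a^'a" and Y :: "complex^'b^'b"
proof -
  have "ptr2 (kron_sum X Y) = ptr2 (kron X (mat 1 :: complex^'b^'b)) + ptr2 (kron (mat 1 :: complex^'a^'a) Y)"
    unfolding kron_sum_def by (rule linear_add[OF ptr2_linear])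
  then show ?thesis
    unfolding ptr2_kron trace_I
    by (simp add: vec_eq_iff mat_def scaleR_conv_of_real[where 'a = complex] mult.commute)
qed

lemma ptr1_kron_sum:
  "ptr1 (kron_sum X Y) = mat (trace X) + real CARD('a) *\<^sub>R Y"
  for X :: "complex^'a^'a" and Y :: "complex^'b^'b"
proof -
  have "ptr1 (kron_sum X Y) = ptr1 (kron X (mat 1 :: complex^'b^'b)) + ptr1 (kron (mat 1 :: complex^'a^'a) Y)"
    unfolding kron_sum_def by (rule linear_add[OF ptr1_linear])
  then show ?thesis
    unfolding ptr1_kron trace_I
    by (simp add: vec_eq_iff mat_def scaleR_conv_of_real[where 'a = complex] mult.commute)
qed

text \<open>The Kronecker sum is the adjoint of the pair of partial traces. This turns the marginal
  constraints into the linear terms of \<open>phi\<close> and makes matrices with vanishing partial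
  traces orthogonal to every Kronecker sum.\<close>

lemma inner_kron_sum: "kron_sum X Y \<bullet> \<rho> = X \<bullet> ptr2 \<rho> + Y \<bullet> ptr1 \<rho>"
  for \<rho> :: "complex^('a::finite \<times> 'b::finite)^('a \<times> 'b)"
proof -
  have "kron X (mat 1) \<bullet> \<rho> = (\<Sum>i\<in>UNIV. \<Sum>k\<in>UNIV. \<Sum>j\<in>UNIV. X $ i $ j \<bullet> \<rho> $ (i, k) $ (j, k))"
  proof -
    have "(X $ i $ j * mat 1 $ k $ l) \<bullet> z = (if k = l then X $ i $ j \<bullet> z else 0)"
      for i j and k l :: 'b and z
      by (simp add: mat_def)
    then show ?thesis by (simp add: inner_vec_def kron_def sum_UNIV_prod)
  qed
  also have "\<dots> = X \<bullet> ptr2 \<rho>"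
    by (simp add: inner_vec_def ptr2_def inner_sum_right)
      (intro sum.cong refl sum.swap)
  finally have 1: "kron X (mat 1) \<bullet> \<rho> = X \<bullet> ptr2 \<rho>" .
  have "kron (mat 1) Y \<bullet> \<rho> = (\<Sum>i\<in>UNIV. \<Sum>k\<in>UNIV. \<Sum>l\<in>UNIV. Y $ k $ l \<bullet> \<rho> $ (i, k) $ (i, l))"
  proof -
    have "(\<Sum>l\<in>UNIV. (mat 1 $ i $ j * Y $ k $ l) \<bullet> z l) =
        (if i = j then (\<Sum>l\<in>UNIV. Y $ k $ l \<bullet> z l) else 0)"
      for i j :: 'a and k and z :: "'b \<Rightarrow> complex"
      by (simp add: mat_def)
    then show ?thesis by (simp add: inner_vec_def kron_def sum_UNIV_prod)
  qed
  also have "\<dots> = (\<Sum>k\<in>UNIV. \<Sum>i\<in>UNIV. \<Sum>l\<in>UNIV. Y $ k $ l \<bullet> \<rho> $ (i, k) $ (i, l))"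
    by (rule sum.swap)
  also have "\<dots> = Y \<bullet> ptr1 \<rho>"
    by (simp add: inner_vec_def ptr1_def inner_sum_right)
      (intro sum.cong refl sum.swap)
  finally show ?thesis by (simp add: kron_sum_def inner_add_left 1)
qed

lemma hermitian_kron_sum: "hermitian X \<Longrightarrow> hermitian Y \<Longrightarrow> hermitian (kron_sum X Y)"
  by (simp add: hermitian_iff_adj kron_sum_def adj_add adj_kron)

lemma kron_sum_scalar: "kron_sum (t *\<^sub>R mat 1) (- (t *\<^sub>R mat 1)) = 0"
  by (simp add: vec_eq_iff kron_sum_def kron_def mat_def)

text \<open>Entries on the diagonal of the first factor make \<open>Y\<close> scalar; entries on the
  diagonal of the second then make \<open>X\<close> the opposite scalar. It is real because
  \<open>X\<close> is Hermitian.\<close>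

lemma kron_sum_eq_0_imp_scalar:
  assumes 0: "kron_sum X Y = 0" and "hermitian X"
  obtains t :: real where "X = t *\<^sub>R mat 1" "Y = - (t *\<^sub>R mat 1)"
proof -
  have e: "X $ i $ j * (if k = l then 1 else 0) + (if i = j then 1 else 0) * Y $ k $ l = 0" for i j k l
  proof -
    have "kron_sum X Y $ (i, k) $ (j, l) = 0" by (simp add: 0)
    then show ?thesis by (simp add: kron_sum_def kron_def mat_def)
  qed
  fix i0 k0
  define t where "t = Re (X $ i0 $ i0)"
  have "cnj (X $ i0 $ i0) = X $ i0 $ i0"
    using \<open>hermitian X\<close> unfolding hermitian_def by metis
  then have t: "X $ i0 $ i0 = of_real t"
    by (simp add: t_def complex_eq_iff)
  have Y: "Y $ k $ l = (if k = l then - of_real t else 0)" for k l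
    using e[of i0 i0 k l] t by (auto simp: add_eq_0_iff)
  have X: "X $ i $ j = (if i = j then of_real t else 0)" for i j
    using e[of i j k0 k0] Y[of k0 k0] by (auto split: if_splits)
  show ?thesis
    by (rule that[of t]) (simp_all add: vec_eq_iff mat_def X Y of_real_def)
qed

lemma adj_ptr2: "adj (ptr2 W) = ptr2 (adj W)"
  by (simp add: vec_eq_iff ptr2_def)

lemma adj_ptr1: "adj (ptr1 W) = ptr1 (adj W)"
  by (simp add: vec_eq_iff ptr1_def)

lemma hermitian_ptr2: "hermitian W \<Longrightarrow> hermitian (ptr2 W)"
  by (simp add: hermitian_iff_adj adj_ptr2)

lemma hermitian_ptr1: "hermitian W \<Longrightarrow> hermitian (ptr1 W)"
  by (simp add: hermitian_iff_adj adj_ptr1)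

lemma hermitian_trace:
  assumes "hermitian A"
  shows "trace A = of_real (Re (trace A))"
proof -
  have "trace (adj A) = cnj (trace A)" by (simp add: trace_def)
  with assms have "cnj (trace A) = trace A" by (simp add: hermitian_iff_adj)
  then show ?thesis by (simp add: complex_eq_iff)
qed

lemma hermitian_add: "hermitian A \<Longrightarrow> hermitian B \<Longrightarrow> hermitian (A + B)"
  by (simp add: hermitian_iff_adj adj_add)

lemma hermitian_diff: "hermitian A \<Longrightarrow> hermitian B \<Longrightarrow> hermitian (A - B)"
  by (simp add: hermitian_iff_adj adj_diff)

lemma hermitian_scaleR: "hermitian A \<Longrightarrow> hermitian (r *\<^sub>R A)"
  by (simp add: hermitian_iff_adj adj_scaleR)

lemma hermitian_mat_1: "hermitian (mat 1)"
  by (simp add: hermitian_iff_adj)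

lemma trace_scaleR: "trace (r *\<^sub>R A) = of_real r * trace A" for A :: "complex^'n^'n"
  by (simp add: trace_def sum_distrib_left scaleR_conv_of_real[where 'a = complex])

text \<open>Subtracting \<open>kron_sum X Y\<close> is the orthogonal projection onto the matrices with vanishing
  partial traces.\<close>
lemma hermitian_kron_sum_projection:
  fixes W :: "complex^('a::finite \<times> 'b::finite)^('a \<times> 'b)"
  assumes W: "hermitian W"
  obtains X Y where "hermitian X" "hermitian Y"
    "ptr2 (W - kron_sum X Y) = 0" "ptr1 (W - kron_sum X Y) = 0"
proof -
  define s where "s = Re (trace W)"
  have s: "trace W = of_real s"
    using hermitian_trace[OF W] by (simp add: s_def)
  \<comment> \<open>The kernel direction \<open>(I, -I)\<close> leaves the normalisation
    \<open>trace X = 0\<close> free. Then \<open>ptr1_kron_sum\<close> determines \<open>Y\<close>,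
    and \<open>ptr2_kron_sum\<close>, with the trace of that \<open>Y\<close>, determines
    \<open>X\<close>.\<close>
  define X where "X = (1 / real CARD('b)) *\<^sub>R ptr2 W - (s / (real CARD('a) * real CARD('b))) *\<^sub>R mat 1"
  define Y where "Y = (1 / real CARD('a)) *\<^sub>R ptr1 W"
  have trX: "trace X = 0"
    by (simp add: X_def trace_sub trace_scaleR trace_ptr2 trace_I s)
  have trY: "trace Y = of_real (s / real CARD('a))"
    by (simp add: Y_def trace_scaleR trace_ptr1 s)
  have "ptr2 (kron_sum X Y) = ptr2 W"
    by (simp add: ptr2_kron_sum trY X_def vec_eq_iff mat_def scaleR_conv_of_real[where 'a = complex] algebra_simps)
  then have "ptr2 (W - kron_sum X Y) = 0"
    by (simp add: linear_diff[OF ptr2_linear])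
  moreover have "ptr1 (kron_sum X Y) = ptr1 W"
    by (simp add: ptr1_kron_sum trX Y_def)
  then have "ptr1 (W - kron_sum X Y) = 0"
    by (simp add: linear_diff[OF ptr1_linear])
  moreover have "hermitian X" "hermitian Y"
    unfolding X_def Y_def
    by (intro hermitian_diff hermitian_scaleR hermitian_mat_1 hermitian_ptr1 hermitian_ptr2 W)+
  ultimately show ?thesis using that by blast
qed

section \<open>Duality\<close>

lemma inner_hermitian_eq_trace: "hermitian A \<Longrightarrow> Re (trace (A ** B)) = A \<bullet> B"
  by (simp add: inner_matrix_eq_trace hermitian_iff_adj)

lemma kappa_obj_eq: "hermitian C \<Longrightarrow> kappa_obj C \<epsilon> \<rho> = C \<bullet> \<rho> - \<epsilon> * ln (Re (det \<rho>))"
  by (simp add: kappa_obj_def inner_hermitian_eq_trace)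

lemma phi_eq:
  fixes \<rho>1 :: "complex^'a::finite^'a" and \<rho>2 :: "complex^'b::finite^'b"
  assumes "hermitian \<rho>1" "hermitian \<rho>2"
  shows "phi \<rho>1 \<rho>2 \<epsilon> C (X, Y) = \<rho>1 \<bullet> X + \<rho>2 \<bullet> Y + \<epsilon> * ln (Re (det (CXY C X Y)))
    + real CARD('a \<times> 'b) * \<epsilon> * (1 - ln \<epsilon>)"
  using assms by (simp add: phi_def betaQ_def inner_hermitian_eq_trace)

text \<open>For feasible \<open>\<rho>\<close>, adjointness gives \<open>CXY C X Y \<bullet> \<rho>
  = C \<bullet> \<rho> - (\<rho>1 \<bullet> X + \<rho>2 \<bullet> Y)\<close>, so the primal value
  minus the dual value is the gap of \<open>trace_ln_det_gap\<close>.\<close>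

lemma duality_gap:
  fixes \<rho>1 :: "complex^'a::finite^'a" and \<rho>2 :: "complex^'b::finite^'b"
    and C \<rho> :: "complex^('a \<times> 'b)^('a \<times> 'b)"
  assumes eps: "0 < \<epsilon>" and R: "hermitian \<rho>1" "hermitian \<rho>2" and C: "hermitian C"
    and \<rho>: "\<rho> \<in> Gamma_o \<rho>1 \<rho>2" and M: "pos_def (CXY C X Y)"
  shows "phi \<rho>1 \<rho>2 \<epsilon> C (X, Y) \<le> kappa_obj C \<epsilon> \<rho>"
    and "phi \<rho>1 \<rho>2 \<epsilon> C (X, Y) = kappa_obj C \<epsilon> \<rho> \<longleftrightarrow> CXY C X Y ** \<rho> = \<epsilon> *\<^sub>R mat 1"
proof -
  have pd: "pos_def \<rho>" and ptr: "ptr2 \<rho> = \<rho>1" "ptr1 \<rho> = \<rho>2"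
    using \<rho> by (auto simp: Gamma_o_def)
  have "CXY C X Y \<bullet> \<rho> = C \<bullet> \<rho> - (\<rho>1 \<bullet> X + \<rho>2 \<bullet> Y)"
    by (simp add: CXY_eq inner_diff_left inner_kron_sum ptr) (simp add: inner_commute)
  then have eq: "kappa_obj C \<epsilon> \<rho> - phi \<rho>1 \<rho>2 \<epsilon> C (X, Y) =
      CXY C X Y \<bullet> \<rho> - \<epsilon> * ln (Re (det \<rho>)) - \<epsilon> * ln (Re (det (CXY C X Y)))
      - real CARD('a \<times> 'b) * \<epsilon> * (1 - ln \<epsilon>)"
    by (simp only: kappa_obj_eq[OF C] phi_eq[OF R])
  note gap = trace_ln_det_gap[OF M pd eps, folded eq]
  show "phi \<rho>1 \<rho>2 \<epsilon> C (X, Y) \<le> kappa_obj C \<epsilon> \<rho>"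
    using gap(1) by linarith
  show "phi \<rho>1 \<rho>2 \<epsilon> C (X, Y) = kappa_obj C \<epsilon> \<rho> \<longleftrightarrow> CXY C X Y ** \<rho> = \<epsilon> *\<^sub>R mat 1"
    unfolding gap(2)[symmetric] by auto
qed

section \<open>Concavity of the dual objective\<close>

lemma CXY_combination:
  assumes "u + v = 1"
  shows "CXY C (u *\<^sub>R X + v *\<^sub>R X') (u *\<^sub>R Y + v *\<^sub>R Y') = u *\<^sub>R CXY C X Y + v *\<^sub>R CXY C X' Y'"
proof -
  have "C = u *\<^sub>R C + v *\<^sub>R C"
    using assms by (simp flip: scaleR_add_left)
  then show ?thesis
    by (simp add: CXY_eq kron_sum_combination algebra_simps)
qed

text \<open>The kernel of the Kronecker sum is the only source of non-uniqueness in the dual; it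
  serves both strict concavity and the description of the maximisers.\<close>

lemma CXY_eq_iff:
  assumes "hermitian X" "hermitian X'"
  shows "CXY C X Y = CXY C X' Y' \<longleftrightarrow> (\<exists>t::real. X = X' + t *\<^sub>R mat 1 \<and> Y = Y' - t *\<^sub>R mat 1)"
proof
  assume "CXY C X Y = CXY C X' Y'"
  then have "kron_sum (X - X') (Y - Y') = 0"
    by (simp add: CXY_eq kron_sum_diff)
  then obtain t :: real where "X - X' = t *\<^sub>R mat 1" "Y - Y' = - (t *\<^sub>R mat 1)"
    using kron_sum_eq_0_imp_scalar hermitian_diff[OF assms] by blast
  then show "\<exists>t::real. X = X' + t *\<^sub>R mat 1 \<and> Y = Y' - t *\<^sub>R mat 1"
    by (intro exI[of _ t]) (simp add: algebra_simps)
next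
  assume "\<exists>t::real. X = X' + t *\<^sub>R mat 1 \<and> Y = Y' - t *\<^sub>R mat 1"
  then obtain t :: real where "X = X' + t *\<^sub>R mat 1" "Y = Y' - t *\<^sub>R mat 1" by blast
  then have "kron_sum (X - X') (Y - Y') = 0" by (simp add: kron_sum_scalar)
  then show "CXY C X Y = CXY C X' Y'" by (simp add: CXY_eq kron_sum_diff)
qed

text \<open>Identifies the parameter at which a line in direction \<open>(I, -I)\<close> meets the
  condition of equal traces.\<close>

lemma trace_shift:
  fixes X :: "complex^'a^'a" and Y :: "complex^'b^'b" and t :: real
  shows "trace (X + t *\<^sub>R mat 1) = trace (Y - t *\<^sub>R mat 1) \<longleftrightarrow>
    trace Y - trace X = of_real (t * (real CARD('a) + real CARD('b)))"
  by (auto simp: trace_add trace_sub trace_scaleR trace_I algebra_simps)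

lemma trace_shift_eq_iff:
  fixes X :: "complex^'a^'a" and Y :: "complex^'b^'b" and t :: real
  assumes "trace X = trace Y"
  shows "trace (X + t *\<^sub>R mat 1) = trace (Y - t *\<^sub>R mat 1) \<longleftrightarrow> t = 0"
proof -
  have "0 < real CARD('a) + real CARD('b)" by (simp add: add_pos_pos)
  moreover have "trace (X + t *\<^sub>R mat 1) = trace (Y - t *\<^sub>R mat 1) \<longleftrightarrow>
      of_real (t * (real CARD('a) + real CARD('b))) = (0 :: complex)"
    using assms by (auto simp: trace_shift)
  ultimately show ?thesis by (simp only: of_real_eq_0_iff mult_eq_0_iff) auto
qed

lemma Dhat_convex_combination:
  assumes "(X, Y) \<in> Dhat C" "(X', Y') \<in> Dhat C" "0 \<le> u" "0 \<le> v" "u + v = 1"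
  shows "(u *\<^sub>R X + v *\<^sub>R X', u *\<^sub>R Y + v *\<^sub>R Y') \<in> Dhat C"
  using assms
  by (auto simp: Dhat_def CXY_combination intro!: hermitian_add hermitian_scaleR
      pos_def_convex_combination)

lemma convex_Dhat: "convex (Dhat C)"
  by (auto simp: convex_def intro!: Dhat_convex_combination)

lemma convex_Dset: "convex (Dset C)"
  by (auto simp: convex_def Dset_def trace_add trace_scaleR intro!: Dhat_convex_combination)

text \<open>The linear and constant terms cancel, so the Jensen defect of \<open>phi\<close> is
  \<open>\<epsilon>\<close> times that of \<open>ln det\<close>.\<close>

lemma phi_combination:
  assumes R: "hermitian \<rho>1" "hermitian \<rho>2" and "u + v = 1"
  shows "phi \<rho>1 \<rho>2 \<epsilon> C (u *\<^sub>R X + v *\<^sub>R X', u *\<^sub>R Y + v *\<^sub>R Y')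
      - (u * phi \<rho>1 \<rho>2 \<epsilon> C (X, Y) + v * phi \<rho>1 \<rho>2 \<epsilon> C (X', Y'))
    = \<epsilon> * (ln (Re (det (u *\<^sub>R CXY C X Y + v *\<^sub>R CXY C X' Y')))
        - (u * ln (Re (det (CXY C X Y))) + v * ln (Re (det (CXY C X' Y')))))"
proof -
  have v: "v = 1 - u" using assms by simp
  show ?thesis
    unfolding phi_eq[OF R] CXY_combination[OF \<open>u + v = 1\<close>]
    by (simp add: v inner_add_right algebra_simps)
qed

lemma concave_on_phi:
  assumes "0 < \<epsilon>" and R: "hermitian \<rho>1" "hermitian \<rho>2"
  shows "concave_on (Dhat C) (phi \<rho>1 \<rho>2 \<epsilon> C)"
  unfolding concave_on_iff
proof (intro conjI convex_Dhat ballI allI impI)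
  fix p q and u v :: real
  assume "p \<in> Dhat C" "q \<in> Dhat C" and uv: "0 \<le> u" "0 \<le> v" "u + v = 1"
  moreover obtain X Y X' Y' where pq: "p = (X, Y)" "q = (X', Y')" by fastforce
  ultimately have "pos_def (CXY C X Y)" "pos_def (CXY C X' Y')"
    by (auto simp: Dhat_def)
  from ln_det_concave(1)[OF this uv] \<open>0 < \<epsilon>\<close>
  have "0 \<le> \<epsilon> * (ln (Re (det (u *\<^sub>R CXY C X Y + v *\<^sub>R CXY C X' Y')))
        - (u * ln (Re (det (CXY C X Y))) + v * ln (Re (det (CXY C X' Y')))))"
    by (intro mult_nonneg_nonneg) auto
  then show "u * phi \<rho>1 \<rho>2 \<epsilon> C p + v * phi \<rho>1 \<rho>2 \<epsilon> C q \<le> phi \<rho>1 \<rho>2 \<epsilon> C (u *\<^sub>R p + v *\<^sub>R q)"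
    using phi_combination[OF R uv(3), of \<epsilon> C X X' Y Y'] by (simp add: pq)
qed

lemma strict_concave_on_phi:
  fixes \<rho>1 :: "complex^'a::finite^'a" and \<rho>2 :: "complex^'b::finite^'b"
  assumes "0 < \<epsilon>" and R: "hermitian \<rho>1" "hermitian \<rho>2"
  shows "strict_concave_on (Dset C) (phi \<rho>1 \<rho>2 \<epsilon> C)"
  unfolding strict_concave_on_def
proof (intro conjI convex_Dset ballI allI impI)
  fix p q and u :: real
  assume p: "p \<in> Dset C" and q: "q \<in> Dset C" and "p \<noteq> q" and u: "0 < u \<and> u < 1"
  obtain X Y X' Y' where pq: "p = (X, Y)" "q = (X', Y')" by fastforce
  from p q pq have pd: "pos_def (CXY C X Y)" "pos_def (CXY C X' Y')"
    and H: "hermitian X" "hermitian X'" and tr: "trace X = trace Y" "trace X' = trace Y'"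
    by (auto simp: Dset_def Dhat_def)
  \<comment> \<open>Points with the same image differ by a multiple of \<open>(I, -I)\<close>, and
    the trace condition makes that multiple zero. Strictness of \<open>ln det\<close> therefore
    carries over.\<close>
  have "CXY C X Y \<noteq> CXY C X' Y'"
  proof
    assume "CXY C X Y = CXY C X' Y'"
    then obtain t :: real where t: "X = X' + t *\<^sub>R mat 1" "Y = Y' - t *\<^sub>R mat 1"
      using CXY_eq_iff[OF H] by blast
    then have "t = 0"
      using tr trace_shift_eq_iff[OF tr(2)] by simp
    with t \<open>p \<noteq> q\<close> pq show False by simp
  qed
  with ln_det_concave(2)[OF pd, of u "1 - u"] u \<open>0 < \<epsilon>\<close>
  have "0 < \<epsilon> * (ln (Re (det (u *\<^sub>R CXY C X Y + (1 - u) *\<^sub>R CXY C X' Y')))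
        - (u * ln (Re (det (CXY C X Y))) + (1 - u) * ln (Re (det (CXY C X' Y')))))"
    by (intro mult_pos_pos) auto
  then show "u * phi \<rho>1 \<rho>2 \<epsilon> C p + (1 - u) * phi \<rho>1 \<rho>2 \<epsilon> C q
      < phi \<rho>1 \<rho>2 \<epsilon> C (u *\<^sub>R p + (1 - u) *\<^sub>R q)"
    using phi_combination[OF R, of u "1 - u" \<epsilon> C X X' Y Y'] by (simp add: pq)
qed

section \<open>Existence of the primal minimiser\<close>

text \<open>The squared norm is the sum of the squared eigenvalues, at most the square of their sum
  since none is negative. Fixed marginals fix the trace, so this bounds the feasible set.\<close>

lemma norm_pos_semidef_le_trace:
  fixes A :: "complex^'n^'n"
  assumes "pos_semidef A"
  shows "norm A \<le> Re (trace A)"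
proof -
  obtain U :: "complex^'n^'n" and d where U: "adj U ** U = mat 1" "U ** adj U = mat 1"
    and A: "A = U ** diag d ** adj U" and d: "\<And>i. 0 \<le> d i"
    using pos_semidef_spectral[OF assms] by blast
  have UAU: "adj U ** A ** U = diag d"
    unfolding A using U by (metis matrix_mul_assoc matrix_mul_lid matrix_mul_rid)
  have "trace A = trace (adj U ** (U ** diag d))"
    unfolding A by (rule trace_mul_sym)
  then have tr: "Re (trace A) = (\<Sum>i\<in>UNIV. d i)"
    by (simp add: matrix_mul_assoc U) (simp add: trace_def diag_def)
  have "A \<bullet> A = diag d \<bullet> diag d"
    using inner_congruence[of "adj U" "diag d" A] by (simp add: UAU flip: A)
  also have "\<dots> = (\<Sum>i\<in>UNIV. d i * d i)"
    by (simp add: inner_matrix_eq_trace diag_mult) (simp add: trace_def diag_def)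
  also have "\<dots> \<le> (\<Sum>i\<in>UNIV. d i * (\<Sum>j\<in>UNIV. d j))"
    using d by (intro sum_mono mult_left_mono member_le_sum) auto
  also have "\<dots> = (Re (trace A))^2"
    by (simp add: tr power2_eq_square sum_distrib_right)
  finally have "norm A ^ 2 \<le> (Re (trace A))^2"
    by (simp add: dot_square_norm)
  moreover have "0 \<le> Re (trace A)"
    unfolding tr using d by (intro sum_nonneg) auto
  ultimately show ?thesis by (rule power2_le_imp_le)
qed

lemma continuous_on_det: "continuous_on S (det :: complex^'n^'n \<Rightarrow> complex)"
  unfolding det_def by (intro continuous_intros)

lemma closed_pos_semidef: "closed {A :: complex^'n^'n. pos_semidef A}"
proof -
  have "closed {A :: complex^'n^'n. adj A = A}"
    unfolding adj_def by (intro closed_Collect_eq continuous_intros)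
  moreover have "closed {A :: complex^'n^'n. \<forall>x. 0 \<le> x \<bullet> (A *v x)}"
    unfolding matrix_vector_mult_def
    by (intro closed_Collect_all closed_Collect_le continuous_intros)
  ultimately show ?thesis
    unfolding pos_semidef_def hermitian_iff_adj by (rule closed_Collect_conj)
qed

text \<open>The product \<open>kron \<rho>1 \<rho>2\<close> divided by the common trace has both
  prescribed marginals.\<close>

lemma Gamma_o_nonempty:
  fixes \<rho>1 :: "complex^'a::finite^'a" and \<rho>2 :: "complex^'b::finite^'b"
  assumes \<rho>: "pos_def \<rho>1" "pos_def \<rho>2" and tr: "trace \<rho>1 = trace \<rho>2"
  shows "Gamma_o \<rho>1 \<rho>2 \<noteq> {}"
proof -
  define \<tau> where "\<tau> = Re (trace \<rho>1)"
  have \<tau>: "trace \<rho>1 = of_real \<tau>" "trace \<rho>2 = of_real \<tau>"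
    using hermitian_trace[OF pos_def_imp_hermitian[OF \<rho>(1)]] tr by (simp_all add: \<tau>_def)
  have "\<rho>1 \<noteq> 0"
    using \<rho>(1) by (auto simp: pos_def_iff dest!: spec[of _ "axis undefined 1"])
  then have "0 < \<tau>"
    using norm_pos_semidef_le_trace[OF pos_def_imp_pos_semidef[OF \<rho>(1)]]
    by (simp add: \<tau>_def flip: zero_less_norm_iff)
  define \<sigma> where "\<sigma> = (1 / \<tau>) *\<^sub>R kron \<rho>1 \<rho>2"
  have "pos_def \<sigma>"
    unfolding \<sigma>_def using \<open>0 < \<tau>\<close> \<rho> by (intro pos_def_scaleR pos_def_kron) auto
  moreover have "ptr2 \<sigma> = \<rho>1" "ptr1 \<sigma> = \<rho>2"
    unfolding \<sigma>_def linear_scale[OF ptr2_linear] linear_scale[OF ptr1_linear]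
    using \<open>0 < \<tau>\<close>
    by (simp_all add: ptr2_kron ptr1_kron vec_eq_iff \<tau> scaleR_conv_of_real[where 'a = complex])
  ultimately show ?thesis by (auto simp: Gamma_o_def)
qed

text \<open>The objective blows up at the boundary: a sublevel set only contains matrices whose
  determinant is bounded away from zero, hence is compact.\<close>
lemma kappa_obj_minimizer:
  fixes \<rho>1 :: "complex^'a::finite^'a" and \<rho>2 :: "complex^'b::finite^'b"
    and C :: "complex^('a \<times> 'b)^('a \<times> 'b)"
  assumes eps: "0 < \<epsilon>" and \<rho>: "pos_def \<rho>1" "pos_def \<rho>2" and tr: "trace \<rho>1 = trace \<rho>2"
    and C: "hermitian C"
  obtains \<rho> where "\<rho> \<in> Gamma_o \<rho>1 \<rho>2" "\<And>\<sigma>. \<sigma> \<in> Gamma_o \<rho>1 \<rho>2 \<Longrightarrow> kappa_obj C \<epsilon> \<rho> \<le> kappa_obj C \<epsilon> \<sigma>"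
proof -
  obtain \<sigma>0 where \<sigma>0: "\<sigma>0 \<in> Gamma_o \<rho>1 \<rho>2"
    using Gamma_o_nonempty[OF \<rho> tr] by blast
  define f where "f = kappa_obj C \<epsilon>"
  \<comment> \<open>\<open>B\<close> bounds \<open>C \<bullet> \<sigma>\<close> in absolute value on
    the feasible set by Cauchy-Schwarz; \<open>c\<close> is the lower bound on the determinant that
    \<open>f \<sigma> \<le> f \<sigma>0\<close> then forces.\<close>
  define B where "B = norm C * Re (trace \<rho>1)"
  define c where "c = exp ((- B - f \<sigma>0) / \<epsilon>)"
  define K where "K = {\<rho>. pos_semidef \<rho> \<and> ptr2 \<rho> = \<rho>1 \<and> ptr1 \<rho> = \<rho>2 \<and> c \<le> Re (det \<rho>)}"
  have "0 < c" by (simp add: c_def)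
  have bound: "norm \<sigma> \<le> Re (trace \<rho>1)" if "pos_semidef \<sigma>" "ptr2 \<sigma> = \<rho>1" for \<sigma> :: "complex^('a \<times> 'b)^('a \<times> 'b)"
    using norm_pos_semidef_le_trace[OF that(1)] that(2) trace_ptr2[of \<sigma>] by simp
  have "bounded K"
    unfolding bounded_iff K_def using bound by blast
  moreover have "closed K"
    unfolding K_def
    by (intro closed_Collect_conj closed_pos_semidef closed_Collect_eq closed_Collect_le
        continuous_intros continuous_on_det linear_continuous_on
        linear_conv_bounded_linear[THEN iffD1] ptr2_linear ptr1_linear)
  ultimately have "compact K"
    by (simp add: compact_eq_bounded_closed)
  have sublevel: "\<sigma> \<in> K" if \<sigma>: "\<sigma> \<in> Gamma_o \<rho>1 \<rho>2" and le: "f \<sigma> \<le> f \<sigma>0" for \<sigma>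
  proof -
    have pd: "pos_def \<sigma>" and ptr: "ptr2 \<sigma> = \<rho>1" "ptr1 \<sigma> = \<rho>2"
      using \<sigma> by (auto simp: Gamma_o_def)
    have "\<bar>C \<bullet> \<sigma>\<bar> \<le> norm C * norm \<sigma>" by (rule Cauchy_Schwarz_ineq2)
    also have "\<dots> \<le> B"
      unfolding B_def using bound[OF pos_def_imp_pos_semidef[OF pd] ptr(1)]
      by (intro mult_left_mono) auto
    finally have "- B - f \<sigma>0 \<le> \<epsilon> * ln (Re (det \<sigma>))"
      using le by (simp add: f_def kappa_obj_eq[OF C])
    then have "(- B - f \<sigma>0) / \<epsilon> \<le> ln (Re (det \<sigma>))"
      using eps by (simp add: pos_divide_le_eq mult.commute)
    then have "c \<le> Re (det \<sigma>)"
      unfolding c_def using pos_def_det(1)[OF pd] by (simp add: ln_ge_iff)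
    then show ?thesis
      using pd ptr by (simp add: K_def pos_def_imp_pos_semidef)
  qed
  then have "K \<noteq> {}" using \<sigma>0 by blast
  have K_pos: "0 < Re (det \<sigma>)" if "\<sigma> \<in> K" for \<sigma>
    using that \<open>0 < c\<close> by (simp add: K_def)
  then have "continuous_on K (\<lambda>\<sigma>. C \<bullet> \<sigma> - \<epsilon> * ln (Re (det \<sigma>)))"
    by (intro continuous_intros continuous_on_det) (metis less_irrefl)
  then have "continuous_on K f"
    by (simp add: f_def kappa_obj_eq[OF C] cong: continuous_on_cong)
  then obtain \<rho> where \<rho>: "\<rho> \<in> K" and min: "\<And>\<sigma>. \<sigma> \<in> K \<Longrightarrow> f \<rho> \<le> f \<sigma>"
    using continuous_attains_inf[OF \<open>compact K\<close> \<open>K \<noteq> {}\<close>] by blast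
  have "\<rho> \<in> Gamma_o \<rho>1 \<rho>2"
    using \<rho> K_pos[OF \<rho>] pos_semidef_pos_def by (auto simp: K_def Gamma_o_def)
  moreover have "f \<rho> \<le> f \<sigma>" if "\<sigma> \<in> Gamma_o \<rho>1 \<rho>2" for \<sigma>
    \<comment> \<open>Outside the sublevel set of \<open>\<sigma>0\<close> the value exceeds
      \<open>f \<sigma>0\<close>, which is at least \<open>f \<rho>\<close> because
      \<open>\<sigma>0\<close> lies in \<open>K\<close>.\<close>
    using sublevel[OF that] min sublevel[OF \<sigma>0] by (meson linorder_linear order_trans order_refl)
  ultimately show ?thesis using that by (simp add: f_def)
qed

text \<open>The gradient of the objective at \<open>\<rho>\<close> is
  \<open>W = C - \<epsilon> *\<^sub>R N\<close>. Its component \<open>Z\<close> with vanishing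
  partial traces is a feasible direction, so stationarity gives \<open>W \<bullet> Z = 0\<close>. As
  \<open>W - Z\<close> is a Kronecker sum, orthogonal to \<open>Z\<close>, it follows that
  \<open>Z = 0\<close>.\<close>

lemma minimizer_stationary:
  fixes \<rho>1 :: "complex^'a::finite^'a" and \<rho>2 :: "complex^'b::finite^'b"
    and C \<rho> :: "complex^('a \<times> 'b)^('a \<times> 'b)"
  assumes eps: "0 < \<epsilon>" and C: "hermitian C" and \<rho>: "\<rho> \<in> Gamma_o \<rho>1 \<rho>2"
    and min: "\<And>\<sigma>. \<sigma> \<in> Gamma_o \<rho>1 \<rho>2 \<Longrightarrow> kappa_obj C \<epsilon> \<rho> \<le> kappa_obj C \<epsilon> \<sigma>"
  obtains X Y where "(X, Y) \<in> Dhat C" "CXY C X Y ** \<rho> = \<epsilon> *\<^sub>R mat 1"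
proof -
  have pd: "pos_def \<rho>" and ptr: "ptr2 \<rho> = \<rho>1" "ptr1 \<rho> = \<rho>2"
    using \<rho> by (auto simp: Gamma_o_def)
  obtain N where N: "pos_def N" "\<rho> ** N = mat 1" "N ** \<rho> = mat 1"
    by (rule pos_def_inverse[OF pd])
  define W where "W = C - \<epsilon> *\<^sub>R N"
  have W: "hermitian W"
    unfolding W_def by (intro hermitian_diff hermitian_scaleR C pos_def_imp_hermitian[OF N(1)])
  obtain X Y where XY: "hermitian X" "hermitian Y"
    "ptr2 (W - kron_sum X Y) = 0" "ptr1 (W - kron_sum X Y) = 0"
    by (rule hermitian_kron_sum_projection[OF W])
  define Z where "Z = W - kron_sum X Y"
  have Z: "hermitian Z"
    unfolding Z_def by (intro hermitian_diff hermitian_kron_sum W XY)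
  have "C \<bullet> Z = \<epsilon> * (Z \<bullet> N)"
  proof (rule ln_det_line_minimum[OF pd N(2) Z])
    fix t assume pdt: "pos_def (\<rho> + t *\<^sub>R Z)"
    have "ptr2 (\<rho> + t *\<^sub>R Z) = \<rho>1" "ptr1 (\<rho> + t *\<^sub>R Z) = \<rho>2"
      using XY(3,4) ptr
      by (simp_all add: Z_def linear_add[OF ptr2_linear] linear_scale[OF ptr2_linear]
          linear_add[OF ptr1_linear] linear_scale[OF ptr1_linear])
    with pdt have "\<rho> + t *\<^sub>R Z \<in> Gamma_o \<rho>1 \<rho>2" by (simp add: Gamma_o_def)
    from min[OF this]
    show "C \<bullet> \<rho> - \<epsilon> * ln (Re (det \<rho>)) \<le> C \<bullet> (\<rho> + t *\<^sub>R Z) - \<epsilon> * ln (Re (det (\<rho> + t *\<^sub>R Z)))"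
      by (simp only: kappa_obj_eq[OF C])
  qed
  then have "W \<bullet> Z = 0"
    by (simp add: W_def inner_diff_left inner_commute[of Z N])
  moreover have "kron_sum X Y \<bullet> Z = 0"
    using XY(3,4) by (simp add: inner_kron_sum Z_def)
  moreover have "Z \<bullet> Z = W \<bullet> Z - kron_sum X Y \<bullet> Z"
    by (simp add: Z_def inner_diff_left)
  ultimately have "Z = 0" by simp
  then have M: "CXY C X Y = \<epsilon> *\<^sub>R N"
    by (simp add: Z_def W_def CXY_eq algebra_simps)
  then have "(X, Y) \<in> Dhat C"
    using XY(1,2) N(1) eps by (simp add: Dhat_def pos_def_scaleR)
  moreover have "CXY C X Y ** \<rho> = \<epsilon> *\<^sub>R mat 1"
    by (simp add: M N(3) flip: scalar_matrix_assoc)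
  ultimately show ?thesis using that by blast
qed

section \<open>Strong duality, the line of maximisers and the unique primal optimum\<close>

theorem theorem1p2:
  fixes \<rho>1 :: "complex^'a::finite^'a" and \<rho>2 :: "complex^'b::finite^'b"
    and C :: "complex^('a \<times> 'b)^('a \<times> 'b)" and \<epsilon> :: real
  assumes "\<epsilon> > 0" and "pos_def \<rho>1" and "pos_def \<rho>2" and "trace \<rho>1 = trace \<rho>2"
    and "hermitian C"
  shows "concave_on (Dhat C) (phi \<rho>1 \<rho>2 \<epsilon> C)
    \<and> strict_concave_on (Dset C) (phi \<rho>1 \<rho>2 \<epsilon> C)
    \<and> (\<exists>U1 U2.
         {p \<in> Dhat C. \<forall>q\<in>Dhat C. phi \<rho>1 \<rho>2 \<epsilon> C q \<le> phi \<rho>1 \<rho>2 \<epsilon> C p}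
           = {(U1 + t *\<^sub>R mat 1, U2 - t *\<^sub>R mat 1) | t::real. True}
       \<and> {(U1 + t *\<^sub>R mat 1, U2 - t *\<^sub>R mat 1) | t::real. True} \<inter> Dset C = {(U1, U2)}
       \<and> (\<forall>q\<in>Dset C. phi \<rho>1 \<rho>2 \<epsilon> C q \<le> phi \<rho>1 \<rho>2 \<epsilon> C (U1, U2))
       \<and> phi \<rho>1 \<rho>2 \<epsilon> C (U1, U2) = kappa_beta C \<rho>1 \<rho>2 \<epsilon>
       \<and> (\<forall>t::real. \<epsilon> *\<^sub>R matrix_inv (CXY C (U1 + t *\<^sub>R mat 1) (U2 - t *\<^sub>R mat 1))
                      = \<epsilon> *\<^sub>R matrix_inv (CXY C U1 U2))
       \<and> {\<rho> \<in> Gamma_o \<rho>1 \<rho>2. \<forall>\<sigma>\<in>Gamma_o \<rho>1 \<rho>2. kappa_obj C \<epsilon> \<rho> \<le> kappa_obj C \<epsilon> \<sigma>}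
           = {\<epsilon> *\<^sub>R matrix_inv (CXY C U1 U2)})"
proof -
  note eps = assms(1) and C = assms(5)
  have R: "hermitian \<rho>1" "hermitian \<rho>2"
    using assms(2,3) by (simp_all add: pos_def_imp_hermitian)
  let ?phi = "phi \<rho>1 \<rho>2 \<epsilon> C" and ?f = "kappa_obj C \<epsilon>" and ?G = "Gamma_o \<rho>1 \<rho>2"
  obtain \<rho> where \<rho>: "\<rho> \<in> ?G" and min: "\<And>\<sigma>. \<sigma> \<in> ?G \<Longrightarrow> ?f \<rho> \<le> ?f \<sigma>"
    using kappa_obj_minimizer[OF assms] by blast
  obtain X Y where XY: "(X, Y) \<in> Dhat C" and M0: "CXY C X Y ** \<rho> = \<epsilon> *\<^sub>R mat 1"
    by (rule minimizer_stationary[OF eps C \<rho> min])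
  have HXY: "hermitian X" "hermitian Y" using XY by (auto simp: Dhat_def)
  \<comment> \<open>The shift along \<open>(I, -I)\<close> that equalises the two traces, solved
    from \<open>trace_shift\<close>.\<close>
  define s where "s = Re (trace Y - trace X) / (real CARD('a) + real CARD('b))"
  define U1 where "U1 = X + s *\<^sub>R mat 1"
  define U2 where "U2 = Y - s *\<^sub>R mat 1"
  define M where "M = CXY C U1 U2"
  have HU: "hermitian U1" "hermitian U2"
    unfolding U1_def U2_def
    by (intro hermitian_add hermitian_diff hermitian_scaleR hermitian_mat_1 HXY)+
  have "M = CXY C X Y"
    unfolding M_def CXY_eq_iff[OF HU(1) HXY(1)] by (auto simp: U1_def U2_def)
  then have M\<rho>: "M ** \<rho> = \<epsilon> *\<^sub>R mat 1" and pd: "pos_def M"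
    using M0 XY by (simp_all add: Dhat_def)
  have "s * (real CARD('a) + real CARD('b)) = Re (trace Y - trace X)"
    using add_pos_pos[of "real CARD('a)" "real CARD('b)"] by (simp add: s_def)
  then have trU: "trace U1 = trace U2"
    unfolding U1_def U2_def trace_shift
    using hermitian_trace[OF HXY(1)] hermitian_trace[OF HXY(2)]
    by (metis minus_complex.sel(1) of_real_diff)
  have U: "(U1, U2) \<in> Dset C"
    using HU pd trU by (simp add: Dset_def Dhat_def M_def)
  \<comment> \<open>The line is exactly the fibre of \<open>CXY C\<close> over \<open>M\<close>;
    maximality will be shown to be equivalent to lying in this fibre.\<close>
  have line: "(V1, V2) \<in> Dhat C \<and> CXY C V1 V2 = M \<longleftrightarrow>
      (\<exists>t::real. V1 = U1 + t *\<^sub>R mat 1 \<and> V2 = U2 - t *\<^sub>R mat 1)" for V1 V2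
  proof
    assume "(V1, V2) \<in> Dhat C \<and> CXY C V1 V2 = M"
    then show "\<exists>t::real. V1 = U1 + t *\<^sub>R mat 1 \<and> V2 = U2 - t *\<^sub>R mat 1"
      using CXY_eq_iff[OF _ HU(1), of V1 C V2 U2] by (auto simp: Dhat_def M_def)
  next
    assume t: "\<exists>t::real. V1 = U1 + t *\<^sub>R mat 1 \<and> V2 = U2 - t *\<^sub>R mat 1"
    then have HV: "hermitian V1" "hermitian V2"
      using HU by (auto intro!: hermitian_add hermitian_diff hermitian_scaleR hermitian_mat_1)
    then have "CXY C V1 V2 = M"
      unfolding M_def CXY_eq_iff[OF HV(1) HU(1)] using t by blast
    with HV pd show "(V1, V2) \<in> Dhat C \<and> CXY C V1 V2 = M" by (simp add: Dhat_def)
  qed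
  have inv_unique: "A = B" if "A ** \<sigma> = \<epsilon> *\<^sub>R mat 1" "B ** \<sigma> = \<epsilon> *\<^sub>R mat 1"
    for A B \<sigma> :: "complex^('a \<times> 'b)^('a \<times> 'b)"
  proof -
    have "A ** ((1 / \<epsilon>) *\<^sub>R \<sigma>) = mat 1" "B ** ((1 / \<epsilon>) *\<^sub>R \<sigma>) = mat 1"
      using that eps by (simp_all add: matrix_scalar_ac flip: scalar_matrix_assoc)
    then have inv: "((1 / \<epsilon>) *\<^sub>R \<sigma>) ** A = mat 1" "B ** ((1 / \<epsilon>) *\<^sub>R \<sigma>) = mat 1"
      by (simp_all add: matrix_left_right_inverse[of A])
    have "B = B ** (((1 / \<epsilon>) *\<^sub>R \<sigma>) ** A)" by (simp only: inv(1) matrix_mul_rid)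
    also have "\<dots> = A" by (simp only: matrix_mul_assoc inv(2) matrix_mul_lid)
    finally show ?thesis by (rule sym)
  qed
  have inv: "M ** \<sigma> = \<epsilon> *\<^sub>R mat 1 \<longleftrightarrow> \<sigma> = \<epsilon> *\<^sub>R matrix_inv M" for \<sigma>
  proof -
    obtain N where N: "M ** N = mat 1" "N ** M = mat 1"
      using pos_def_inverse[OF pd] by blast
    have "\<sigma> = \<epsilon> *\<^sub>R N" if "M ** \<sigma> = \<epsilon> *\<^sub>R mat 1"
    proof -
      have "\<sigma> = N ** (M ** \<sigma>)" by (simp add: matrix_mul_assoc N)
      then show ?thesis by (simp add: that matrix_scalar_ac flip: scalar_matrix_assoc)
    qed
    then show ?thesis
      using N by (auto simp: matrix_inv_eq[OF N(1)] matrix_scalar_ac simp flip: scalar_matrix_assoc)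
  qed
  have opt: "?phi (U1, U2) = ?f \<rho>"
    using duality_gap(2)[OF eps R C \<rho>, of U1 U2] M\<rho> pd by (simp add: M_def)
  have Dhat_le: "?phi q \<le> ?f \<rho>" and Dhat_eq: "?phi q = ?f \<rho> \<longleftrightarrow> CXY C (fst q) (snd q) = M"
    if "q \<in> Dhat C" for q
  proof -
    have pdq: "pos_def (CXY C (fst q) (snd q))" using that by (auto simp: Dhat_def)
    show "?phi q \<le> ?f \<rho>" using duality_gap(1)[OF eps R C \<rho> pdq] by simp
    show "?phi q = ?f \<rho> \<longleftrightarrow> CXY C (fst q) (snd q) = M"
      using duality_gap(2)[OF eps R C \<rho> pdq] inv_unique M\<rho> by auto
  qed
  have U_Dhat: "(U1, U2) \<in> Dhat C" using U by (simp add: Dset_def)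
  let ?L = "{(U1 + t *\<^sub>R mat 1, U2 - t *\<^sub>R mat 1) | t::real. True}"
  have argmax: "{p \<in> Dhat C. \<forall>q\<in>Dhat C. ?phi q \<le> ?phi p} = ?L"
  proof -
    \<comment> \<open>The bound \<open>?f \<rho>\<close> is attained at \<open>(U1, U2)\<close>, so
      maximising means attaining it, which the equality case of duality translates into
      \<open>CXY C (fst p) (snd p) = M\<close>.\<close>
    have "p \<in> Dhat C \<and> (\<forall>q\<in>Dhat C. ?phi q \<le> ?phi p) \<longleftrightarrow> p \<in> Dhat C \<and> ?phi p = ?f \<rho>" for p
      using Dhat_le U_Dhat opt by (metis order_antisym)
    also have "p \<in> Dhat C \<and> ?phi p = ?f \<rho> \<longleftrightarrow> p \<in> Dhat C \<and> CXY C (fst p) (snd p) = M" for p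
      using Dhat_eq by blast
    also have "p \<in> Dhat C \<and> CXY C (fst p) (snd p) = M \<longleftrightarrow> p \<in> ?L" for p
      using line[of "fst p" "snd p"] by (cases p) auto
    finally show ?thesis by blast
  qed
  have L_Dset: "?L \<inter> Dset C = {(U1, U2)}"
  proof -
    have "t = 0" if "(U1 + t *\<^sub>R mat 1, U2 - t *\<^sub>R mat 1) \<in> Dset C" for t :: real
      using that trace_shift_eq_iff[OF trU] by (simp add: Dset_def)
    moreover have "(U1, U2) \<in> ?L" by (auto intro!: exI[of _ 0])
    ultimately show ?thesis using U by auto
  qed
  have kappa: "?phi (U1, U2) = kappa_beta C \<rho>1 \<rho>2 \<epsilon>"
    unfolding kappa_beta_def opt using \<rho> min by (intro cInf_eq_minimum[symmetric]) auto
  have const: "CXY C (U1 + t *\<^sub>R mat 1) (U2 - t *\<^sub>R mat 1) = M" for t :: real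
    using line[of "U1 + t *\<^sub>R mat 1" "U2 - t *\<^sub>R mat 1"] by blast
  have argmin: "{\<sigma> \<in> ?G. \<forall>\<tau>\<in>?G. ?f \<sigma> \<le> ?f \<tau>} = {\<epsilon> *\<^sub>R matrix_inv M}"
  proof -
    have S: "\<epsilon> *\<^sub>R matrix_inv M = \<rho>" using inv M\<rho> by simp
    \<comment> \<open>The same equality case with the dual point fixed and the primal point varying:
      a second minimiser would also satisfy
      \<open>M ** \<sigma> = \<epsilon> *\<^sub>R mat 1\<close>, whose only solution is
      \<open>\<rho>\<close>.\<close>
    have eq: "?f \<sigma> = ?f \<rho> \<longleftrightarrow> \<sigma> = \<rho>" if "\<sigma> \<in> ?G" for \<sigma>
    proof -
      have "?f \<sigma> = ?f \<rho> \<longleftrightarrow> ?phi (U1, U2) = ?f \<sigma>" using opt by auto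
      also have "\<dots> \<longleftrightarrow> M ** \<sigma> = \<epsilon> *\<^sub>R mat 1"
        by (rule duality_gap(2)[OF eps R C that pd[unfolded M_def], folded M_def])
      finally show ?thesis by (simp only: inv S)
    qed
    have "\<sigma> = \<rho>" if "\<sigma> \<in> ?G" "\<forall>\<tau>\<in>?G. ?f \<sigma> \<le> ?f \<tau>" for \<sigma>
      using eq[OF that(1)] min[OF that(1)] that(2) \<rho> by (meson order_antisym)
    then show ?thesis unfolding S using \<rho> min by blast
  qed
  show ?thesis
    using concave_on_phi[OF eps R] strict_concave_on_phi[OF eps R] argmax L_Dset kappa argmin
      Dhat_le opt
    by (intro conjI exI[of _ U1] exI[of _ U2]) (auto simp: const Dset_def simp flip: M_def)
qed

end
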